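(* Let $1\le p_0<p<q_0\le\infty$, let $\mathcal S\subset\mathcal D$ be a sparse family, and let $(w,\sigma)$ be a pair of weights. Put $$u:=w^{\frac{p_0}{p_0-p}},\qquad v:=\sigma^{\frac{q_0'}{q_0'-p'}},$$ which are assumed to be weights (locally integrable). Let $\mathcal N\in[0,\infty]$ be the best constant such that $$\sum_{Q\in\mathcal S}\langle |f|^{p_0}\rangle_Q^{\frac1{p_0}}\,\langle |g|^{q_0'}\rangle_Q^{\frac1{q_0'}}\,|Q|\le \mathcal N\,\|f\|_{L^p(w)}\,\|g\|_{L^{p'}(\sigma)}$$ holds for all $f\in L^p(w)$ and $g\in L^{p'}(\sigma)$. Then $$\mathcal N\lesssim [v,u]_{A_r}^{\frac1{q_0'}-\frac1{p'}}\Big([u]_{A_\infty}^{\frac1p}+[v]_{A_\infty}^{\frac1{p'}}\Big),$$ where $$r=\Big(\frac{q_0}{p}\Big)'\Big(\frac p{p_0}-1\Big)+1 .$$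
   Context: Setting: $(X,d)$ is a locally compact separable metric space equipped with a doubling Borel measure $\mu$, finite on compact sets and strictly positive on nonempty open sets. Write $|E|:=\mu(E)$ and $dx$ for $d\mu$. $\mathcal D$ is a fixed dyadic system on $X$: $\mathcal D=\bigcup_{k\in\mathbb Z}\mathcal D_k$, where each $\mathcal D_k$ is a countable partition of $X$ into Borel sets ("cubes"), any two cubes are either disjoint or nested (with $\mathcal D_{k+1}$ refining $\mathcal D_k$), and, for some fixed $\delta\in(0,1)$ and $0<c\le C<\infty$, each $Q\in\mathcal D_k$ has a point $z_Q$ with $B(z_Q,c\delta^k)\subset Q\subset B(z_Q,C\delta^k)$. (On $\mathbb R^n$ with Lebesgue measure one may take the usual dyadic cubes.) A family $\mathcal S\subset\mathcal D$ is sparse if $\big|\bigcup_{Q'\in\mathcal S,\,Q'\subsetneq Q}Q'\big|\le\frac12|Q|$ for every $Q\in\mathcal S$. A weight is a locally integrable, a.e. positive function; for a weight $w$, $w(E):=\int_E w\,dx$ and $\|f\|_{L^p(w)}=(\int|f|^p w\,dx)^{1/p}$. Averages: $\langle h\rangle_Q:=\frac1{|Q|}\int_Q h\,dx$. For an exponent $t$, $t'$ is its conjugate exponent, $1/t+1/t'=1$, with $1/\infty=0$ and $\infty'=1$. $[v,u]_{A_r}:=\sup_Q\langle v\rangle_Q\langle u\rangle_Q^{r-1}$, and $[v]_{A_\infty}:=\sup_Q\frac1{v(Q)}\int_Q M(v\mathbf 1_Q)\,dx$, the suprema being over all cubes $Q$, where $M$ is the Hardy–Littlewood maximal operator $Mh(x)=\sup_{B\ni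 x}\frac1{|B|}\int_B|h|$ over balls. The notation $a\lesssim b$ means $a\le Cb$ with $C$ independent of $w,\sigma,\mathcal S$ (it may depend on $p_0,q_0,p$ and the underlying space). *)

theory Defs
  imports "HOL-Analysis.Analysis"
begin

section \<open>Exponents\<close>

text \<open>For \<open>t \<ge> 1\<close> (including \<open>t = \<infinity>\<close>) this is the solution of \<open>1/t + 1/t' = 1\<close>; in
  \<^typ>\<open>ereal\<close> we have \<open>1/\<infinity> = 0\<close> and \<open>1/0 = \<infinity>\<close>, so \<open>\<infinity>' = 1\<close> and \<open>1' = \<infinity>\<close>.\<close>

definition conj_exponent :: "ereal \<Rightarrow> ereal" where
  "conj_exponent t = 1 / (1 - 1 / t)"

lemma conj_exponent_infinity [simp]: "conj_exponent \<infinity> = 1"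
  by (simp add: conj_exponent_def)

lemma conj_exponent_one [simp]: "conj_exponent 1 = \<infinity>"
  by (simp add: conj_exponent_def divide_ereal_def one_ereal_def zero_ereal_def)

lemma conj_exponent_ereal: "1 < t \<Longrightarrow> conj_exponent (ereal t) = ereal (t / (t - 1))"
  by (simp add: conj_exponent_def one_ereal_def divide_simps)

lemma conj_exponent_sum:
  assumes "1 \<le> t"
  shows "1 / t + 1 / conj_exponent t = 1"
proof (cases t)
  case (real s)
  show ?thesis
  proof (cases "s = 1")
    case True
    then have "t = 1" using real by (simp add: one_ereal_def)
    then show ?thesis by simp
  next
    case False
    with assms real have "1 < s" by (simp add: one_ereal_def)
    then show ?thesis using real
      by (simp add: conj_exponent_ereal) (simp add: one_ereal_def field_simps)
  qed
qed (use assms in auto)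

text \<open>Powers of \<^typ>\<open>ennreal\<close> numbers; meant for exponents \<open>a > 0\<close> only (then \<open>0 ^ a = 0\<close> and
  \<open>\<infinity> ^ a = \<infinity>\<close>).\<close>

definition ennpowr :: "ennreal \<Rightarrow> real \<Rightarrow> ennreal" (infixr "powr\<^sub>e" 80) where
  "x powr\<^sub>e a = (if x = \<infinity> then \<infinity> else ennreal (enn2real x powr a))"


section \<open>The space and the dyadic system\<close>

definition doubling_measure :: "'a::metric_space measure \<Rightarrow> bool" where
  "doubling_measure \<mu> \<longleftrightarrow>
     (\<exists>K::real. \<forall>x r. 0 < r \<longrightarrow> emeasure \<mu> (ball x (2 * r)) \<le> ennreal K * emeasure \<mu> (ball x r))"

definition doubling_space :: "'a::metric_space measure \<Rightarrow> bool" where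
  "doubling_space \<mu> \<longleftrightarrow>
     locally_compact_space (euclidean :: 'a topology) \<and>
     separable_space (euclidean :: 'a topology) \<and>
     sets \<mu> = sets borel \<and>
     doubling_measure \<mu> \<and>
     (\<forall>K. compact K \<longrightarrow> emeasure \<mu> K < \<infinity>) \<and>
     (\<forall>U. open U \<and> U \<noteq> {} \<longrightarrow> 0 < emeasure \<mu> U)"

definition dyadic_system :: "(int \<Rightarrow> 'a::metric_space set set) \<Rightarrow> bool" where
  "dyadic_system \<D> \<longleftrightarrow>
     (\<forall>k. countable (\<D> k) \<and> \<D> k \<subseteq> sets borel \<and> partition_on UNIV (\<D> k)) \<and>
     (\<forall>k. refines UNIV (\<D> (k + 1)) (\<D> k)) \<and>
     (\<forall>P\<in>(\<Union>k. \<D> k). \<forall>Q\<in>(\<Union>k. \<D> k). P \<inter> Q = {} \<or> P \<subseteq> Q \<or> Q \<subseteq> P) \<and>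
     (\<exists>\<delta> c C :: real. 0 < \<delta> \<and> \<delta> < 1 \<and> 0 < c \<and> c \<le> C \<and>
        (\<forall>k. \<forall>Q\<in>\<D> k. \<exists>z. ball z (c * \<delta> powi k) \<subseteq> Q \<and> Q \<subseteq> ball z (C * \<delta> powi k)))"

text \<open>Cubes are sets: one that belongs to several generations counts once.\<close>

definition sparse_family :: "'a measure \<Rightarrow> 'a set set \<Rightarrow> bool" where
  "sparse_family \<mu> \<S> \<longleftrightarrow>
     (\<forall>Q\<in>\<S>. emeasure \<mu> (\<Union>{Q'\<in>\<S>. Q' \<subset> Q}) \<le> emeasure \<mu> Q / 2)"


section \<open>Weights\<close>

text \<open>Local integrability is integrability on compact sets. The space need not be proper, so a weight
  may have infinite mass on a cube; therefore all integrals below take values in \<open>[0, \<infinity>]\<close>.\<close>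

definition weight :: "'a::metric_space measure \<Rightarrow> ('a \<Rightarrow> real) \<Rightarrow> bool" where
  "weight \<mu> w \<longleftrightarrow>
     w \<in> borel_measurable \<mu> \<and>
     (AE x in \<mu>. 0 < w x) \<and>
     (\<forall>K. compact K \<longrightarrow> set_integrable \<mu> K w)"

text \<open>The integral and the average of a function that is nonnegative almost everywhere.\<close>

definition mass :: "'a measure \<Rightarrow> ('a \<Rightarrow> real) \<Rightarrow> 'a set \<Rightarrow> ennreal" where
  "mass \<mu> h E = (\<integral>\<^sup>+x\<in>E. ennreal (h x) \<partial>\<mu>)"

definition average :: "'a measure \<Rightarrow> ('a \<Rightarrow> real) \<Rightarrow> 'a set \<Rightarrow> ennreal" where
  "average \<mu> h Q = mass \<mu> h Q / emeasure \<mu> Q"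

definition Lp_norm :: "'a measure \<Rightarrow> real \<Rightarrow> ('a \<Rightarrow> real) \<Rightarrow> ('a \<Rightarrow> real) \<Rightarrow> ennreal" where
  "Lp_norm \<mu> p w f = (\<integral>\<^sup>+x. ennreal (\<bar>f x\<bar> powr p * w x) \<partial>\<mu>) powr\<^sub>e (1 / p)"

definition Lp_space :: "'a measure \<Rightarrow> real \<Rightarrow> ('a \<Rightarrow> real) \<Rightarrow> ('a \<Rightarrow> real) set" where
  "Lp_space \<mu> p w = {f \<in> borel_measurable \<mu>. Lp_norm \<mu> p w f < \<infinity>}"

definition HL_maximal :: "'a::metric_space measure \<Rightarrow> ('a \<Rightarrow> real) \<Rightarrow> 'a \<Rightarrow> ennreal" where
  "HL_maximal \<mu> h x =
     (SUP (y, r) \<in> {(y, r). 0 < r \<and> x \<in> ball y r}. average \<mu> (\<lambda>z. \<bar>h z\<bar>) (ball y r))"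

definition Ar_const ::
    "'a measure \<Rightarrow> (int \<Rightarrow> 'a set set) \<Rightarrow> real \<Rightarrow> ('a \<Rightarrow> real) \<Rightarrow> ('a \<Rightarrow> real) \<Rightarrow> ennreal" where
  "Ar_const \<mu> \<D> r v u =
     (SUP Q \<in> (\<Union>k. \<D> k). average \<mu> v Q * average \<mu> u Q powr\<^sub>e (r - 1))"

text \<open>In \<^typ>\<open>ennreal\<close> a cube with \<open>v(Q) = \<infinity>\<close> contributes \<open>\<infinity> / \<infinity> = 0\<close> here. For a pair of weights with
  an infinite mass on some cube, \<^term>\<open>Ar_const\<close> with \<open>r > 1\<close> is \<open>\<infinity>\<close>.\<close>

definition Ainf_const ::
    "'a::metric_space measure \<Rightarrow> (int \<Rightarrow> 'a set set) \<Rightarrow> ('a \<Rightarrow> real) \<Rightarrow> ennreal" where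
  "Ainf_const \<mu> \<D> v =
     (SUP Q \<in> (\<Union>k. \<D> k). (\<integral>\<^sup>+x\<in>Q. HL_maximal \<mu> (\<lambda>z. v z * indicator Q z) x \<partial>\<mu>) / mass \<mu> v Q)"


section \<open>The sparse form\<close>

definition sparse_form ::
    "'a measure \<Rightarrow> 'a set set \<Rightarrow> real \<Rightarrow> real \<Rightarrow> ('a \<Rightarrow> real) \<Rightarrow> ('a \<Rightarrow> real) \<Rightarrow> ennreal" where
  "sparse_form \<mu> \<S> a b f g =
     (\<Sum>\<^sub>\<infinity>Q\<in>\<S>. average \<mu> (\<lambda>x. \<bar>f x\<bar> powr a) Q powr\<^sub>e (1 / a)
            * average \<mu> (\<lambda>x. \<bar>g x\<bar> powr b) Q powr\<^sub>e (1 / b) * emeasure \<mu> Q)"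

definition best_const ::
    "'a measure \<Rightarrow> 'a set set \<Rightarrow> real \<Rightarrow> real \<Rightarrow> real \<Rightarrow> real \<Rightarrow>
      ('a \<Rightarrow> real) \<Rightarrow> ('a \<Rightarrow> real) \<Rightarrow> ennreal" where
  "best_const \<mu> \<S> a b p p' w \<sigma> =
     Inf {N. \<forall>f\<in>Lp_space \<mu> p w. \<forall>g\<in>Lp_space \<mu> p' \<sigma>.
               sparse_form \<mu> \<S> a b f g \<le> N * Lp_norm \<mu> p w f * Lp_norm \<mu> p' \<sigma> g}"

end

theory Submission
  imports Defs
begin

text \<open>
  Write \<open>F = \<bar>f\<bar>\<^bsup>p\<^sub>0\<^esup> / u\<close> and \<open>G = \<bar>g\<bar>\<^bsup>q\<^sub>0'\<^esup> / v\<close>. The weights \<open>u\<close> and \<open>v\<close> are chosen so that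
  the norms of \<open>f\<close> and \<open>g\<close> become, up to powers, the norms of \<open>F\<close> in \<open>L\<^sup>s(u)\<close> with
  \<open>s = p/p\<^sub>0\<close> and of \<open>G\<close> in \<open>L\<^sup>t(v)\<close> with \<open>t = p'/q\<^sub>0'\<close> (\<open>change_of_weight\<close>). With \<open>\<phi>(Q)\<close>
  and \<open>\<psi>(Q)\<close> denoting the averages of \<open>F\<close> and \<open>G\<close> over \<open>Q\<close> with respect to \<open>u dx\<close> and
  \<open>v dx\<close>, the sparse form is the sum over \<open>Q\<close> of \<open>\<phi>(Q)\<^bsup>1/p\<^sub>0\<^esup> \<psi>(Q)\<^bsup>1/q\<^sub>0'\<^esup> T(Q)\<close>, where
  \<open>T(Q)\<close> depends on \<open>u(Q)\<close>, \<open>v(Q)\<close> and \<open>\<bar>Q\<bar>\<close> alone.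

  \<^bold>\<open>Why the two characteristics are added.\<close> Put \<open>\<gamma> = 1/q\<^sub>0' - 1/p'\<close>; then
  \<open>\<gamma> (r - 1) = 1/p\<^sub>0 - 1/p\<close>, so that the \<open>A\<^sub>r\<close> condition bounds \<open>T(Q)\<close> by
  \<open>[v,u]\<^sup>\<gamma> u(Q)\<^bsup>1/p\<^esup> v(Q)\<^bsup>1/p'\<^esup>\<close>. Hoelder's inequality and two Carleson embeddings would now
  give the product of the two \<open>A\<^sub>\<infinity>\<close> factors instead of their sum. To gain, the cubes are
  grouped into strata on which the product in the \<open>A\<^sub>r\<close> condition is comparable to \<open>2\<^sup>k\<close>.
  Inside one stratum the averages of \<open>u\<close> and \<open>v\<close> determine each other up to constants, and
  \<open>T(Q)\<close> is comparable to a multiple, depending on \<open>k\<close> only, of \<open>u(Q)\<^sup>x v(Q)\<^sup>y \<bar>Q\<bar>\<^sup>z\<close> with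
  \<open>x + y + z = 1\<close> and \<open>z > 0\<close>. The sum of such expressions over the subcubes of \<open>R\<close> is
  dominated by the term of \<open>R\<close> itself, because sparseness makes the measure of successive
  generations decay geometrically (\<open>sparse_sum_le\<close>). This gives a testing estimate without
  any \<open>A\<^sub>\<infinity>\<close> loss (\<open>stratum_testing\<close>), with a constant proportional to \<open>2\<^bsup>k\<gamma>\<^esup>\<close>, and the
  strata sum up to a multiple of \<open>[v,u]\<^sup>\<gamma>\<close>.

  Next, \<open>\<phi>\<close> and \<open>\<psi>\<close> are replaced by the dyadic sizes \<open>2\<^sup>i\<close> and \<open>2\<^sup>j\<close> of their maxima over the
  larger cubes of the family. The levels \<open>i\<close> and \<open>j\<close> do not decrease as cubes shrink, so
  every cube lies below a maximal cube with the same pair \<open>(i,j)\<close>, and such a maximal cube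
  is maximal for \<open>i\<close> alone or for \<open>j\<close> alone (\<open>ex_top_above\<close>). By the testing estimate only
  these tops have to be summed (\<open>bilinear_embedding\<close>). On the tops for \<open>i\<close>, Hoelder's
  inequality leaves two sums. The one with \<open>u\<close> runs over disjoint cubes on each level and is
  controlled by Doob's inequality with no weight constant (\<open>doob_tops\<close>). The one with \<open>v\<close> is
  a Carleson embedding and costs the \<open>A\<^sub>\<infinity>\<close> constant of \<open>v\<close> to the power \<open>1/p'\<close>
  (\<open>Carleson_mass\<close>). The tops for \<open>j\<close> give that of \<open>u\<close> to the power \<open>1/p\<close> in the same way.

  \<^bold>\<open>Finiteness.\<close> The sparse form is a supremum over finite subfamilies, so all of this is done
  with finite sums of real numbers. This requires finite masses on all cubes, which a finite
  \<open>A\<^sub>r\<close> constant provides (\<open>Ar_finite_mass\<close>). If one of the three constants is infinite, the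
  right-hand side is infinite, because the other factors are positive; for the \<open>A\<^sub>\<infinity>\<close>
  constants this uses that small cubes have finite mass (\<open>Ainf_pos\<close>).
\<close>

section \<open>Hoelder's inequality for finite sums and geometric sums\<close>

text \<open>After dividing by the three bounds, this is the weighted inequality of arithmetic and
  geometric means in each term.\<close>

lemma Hoelder3_sum:
  fixes a b c :: "'i \<Rightarrow> real"
  assumes pos: "\<And>i. i \<in> I \<Longrightarrow> 0 < a i \<and> 0 < b i \<and> 0 < c i"
    and xyz: "0 \<le> x" "0 \<le> y" "0 \<le> z" "x + y + z = 1"
    and sums: "sum a I \<le> A" "sum b I \<le> B" "sum c I \<le> C" "0 < A" "0 < B" "0 < C"
  shows "(\<Sum>i\<in>I. a i powr x * b i powr y * c i powr z) \<le> A powr x * B powr y * C powr z"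
proof -
  have amgm: "s powr x * t powr y * u powr z \<le> x * s + y * t + z * u" if "0 < s" "0 < t" "0 < u" for s t u :: real
  proof (cases "x + y = 0")
    case True
    then have "x = 0" "y = 0" "z = 1" using xyz by auto
    then show ?thesis using that by simp
  next
    case False
    define e where "e = x + y"
    have e: "0 < e" using False xyz by (simp add: e_def)
    define g where "g = s powr (x / e) * t powr (y / e)"
    have g: "0 < g" using that by (simp add: g_def)
    have "g \<le> x / e * s + y / e * t"
      unfolding g_def by (rule Youngs_inequality_0) (use xyz e that in \<open>auto simp: e_def add_divide_distrib[symmetric]\<close>)
    then have 1: "e * g \<le> x * s + y * t" using e by (simp add: field_simps)
    have "g powr e * u powr z \<le> e * g + z * u"
      by (rule Youngs_inequality_0) (use xyz e that g in \<open>auto simp: e_def\<close>)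
    moreover have "g powr e = s powr x * t powr y"
      using e that by (simp add: g_def powr_mult powr_powr)
    ultimately show ?thesis using 1 by simp
  qed
  have le: "a i powr x * b i powr y * c i powr z
      \<le> A powr x * B powr y * C powr z * (x * (a i / A) + y * (b i / B) + z * (c i / C))" if "i \<in> I" for i
  proof -
    have "(a i / A) powr x * (b i / B) powr y * (c i / C) powr z \<le> x * (a i / A) + y * (b i / B) + z * (c i / C)"
      using pos[OF that] sums by (intro amgm) auto
    then have "A powr x * B powr y * C powr z * ((a i / A) powr x * (b i / B) powr y * (c i / C) powr z)
      \<le> A powr x * B powr y * C powr z * (x * (a i / A) + y * (b i / B) + z * (c i / C))"
      by (intro mult_left_mono) auto
    also have "A powr x * B powr y * C powr z * ((a i / A) powr x * (b i / B) powr y * (c i / C) powr z)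
       = a i powr x * b i powr y * c i powr z"
      using pos[OF that] sums by (simp add: powr_divide)
    finally show ?thesis .
  qed
  have "(\<Sum>i\<in>I. a i powr x * b i powr y * c i powr z)
     \<le> (\<Sum>i\<in>I. A powr x * B powr y * C powr z * (x * (a i / A) + y * (b i / B) + z * (c i / C)))"
    by (rule sum_mono) (rule le)
  also have "\<dots> = A powr x * B powr y * C powr z * (x * (sum a I / A) + y * (sum b I / B) + z * (sum c I / C))"
    unfolding sum_distrib_left[symmetric] by (simp add: sum.distrib sum_distrib_left[symmetric] sum_divide_distrib[symmetric])
  also have "\<dots> \<le> A powr x * B powr y * C powr z * (x * 1 + y * 1 + z * 1)"
    using xyz sums by (intro mult_left_mono add_mono) auto
  finally show ?thesis using xyz by simp
qed

lemma Hoelder_sum: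
  fixes a b :: "'i \<Rightarrow> real"
  assumes "finite I" and pos: "\<And>i. i \<in> I \<Longrightarrow> 0 < a i \<and> 0 < b i"
    and "0 < p" "0 < p'" "1 / p + 1 / p' = 1"
    and "sum a I \<le> A" "sum b I \<le> B"
  shows "(\<Sum>i\<in>I. a i powr (1 / p) * b i powr (1 / p')) \<le> A powr (1 / p) * B powr (1 / p')"
proof (cases "I = {}")
  case False
  have "0 < sum a I" "0 < sum b I" using False assms by (auto intro!: sum_pos)
  then have "0 < A" "0 < B" using assms by linarith+
  \<comment> \<open>The third factor gets the exponent 0; its bound only has to be positive.\<close>
  then have "(\<Sum>i\<in>I. a i powr (1 / p) * b i powr (1 / p') * 1 powr 0)
      \<le> A powr (1 / p) * B powr (1 / p') * (1 + real (card I)) powr 0"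
    using assms by (intro Hoelder3_sum) auto
  then show ?thesis by simp
qed auto

text \<open>A geometric series whose largest term is at most \<open>y\<^sup>e\<close>. It sums both the strata and, at a
  fixed point, the levels in Doob's inequality.\<close>

lemma sum_powers_of_two_le:
  fixes e y :: real
  assumes "finite I" "0 < e" and le: "\<And>i. i \<in> I \<Longrightarrow> 2 powr real_of_int i \<le> y" and y: "0 < y"
  shows "(\<Sum>i\<in>I. 2 powr (e * real_of_int i)) \<le> y powr e / (1 - 2 powr - e)"
proof -
  define N where "N = \<lfloor>log 2 y\<rfloor>"
  define q :: real where "q = 2 powr - e"
  have q: "0 < q" "q < 1" using assms(2) by (auto simp: q_def powr_less_one)
  have N: "i \<le> N" if "i \<in> I" for i
    using le[OF that] y by (auto simp: N_def le_floor_iff le_log_iff)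
  have inj: "inj_on (\<lambda>i. nat (N - i)) I"
    using N by (auto simp: inj_on_def) (metis N diff_ge_0_iff_ge eq_nat_nat_iff diff_left_imp_eq)
  have eq: "2 powr (e * real_of_int i) = 2 powr (e * N) * q ^ nat (N - i)" if "i \<in> I" for i
  proof -
    have "q ^ nat (N - i) = q powr real (nat (N - i))" using q by (simp add: powr_realpow)
    also have "\<dots> = 2 powr (- e * (N - i))" using N[OF that] by (simp add: q_def powr_powr)
    finally show ?thesis by (simp add: powr_add[symmetric] algebra_simps)
  qed
  have "(\<Sum>i\<in>I. 2 powr (e * real_of_int i)) = 2 powr (e * N) * (\<Sum>i\<in>I. q ^ nat (N - i))"
    by (simp add: eq sum_distrib_left)
  also have "(\<Sum>i\<in>I. q ^ nat (N - i)) = (\<Sum>n\<in>(\<lambda>i. nat (N - i)) ` I. q ^ n)"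
    by (simp add: sum.reindex[OF inj])
  also have "\<dots> \<le> suminf (\<lambda>n. q ^ n)"
    using q assms(1) by (intro sum_le_suminf) (auto intro!: summable_geometric)
  also have "\<dots> = 1 / (1 - q)" using q by (intro suminf_geometric) auto
  finally have "(\<Sum>i\<in>I. 2 powr (e * real_of_int i)) \<le> 2 powr (e * N) * (1 / (1 - q))"
    by simp
  also have "2 powr (e * N) \<le> y powr e"
  proof -
    have "2 powr (e * N) \<le> 2 powr (e * log 2 y)"
      using assms(2) by (intro powr_mono mult_left_mono) (auto simp: N_def)
    also have "\<dots> = (2 powr log 2 y) powr e" by (simp add: powr_powr mult.commute)
    also have "\<dots> = y powr e" using y by simp
    finally show ?thesis .
  qed
  finally show ?thesis using q by (simp add: q_def[symmetric] divide_right_mono)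
qed

section \<open>Laminar families and the tops of their levels\<close>

text \<open>The empty set is excluded so that the members containing a given member form a chain.\<close>

definition laminar :: "'a set set \<Rightarrow> bool" where
  "laminar S \<longleftrightarrow> {} \<notin> S \<and> (\<forall>P\<in>S. \<forall>Q\<in>S. P \<inter> Q = {} \<or> P \<subseteq> Q \<or> Q \<subseteq> P)"

lemma laminar_subset: "laminar S \<Longrightarrow> S' \<subseteq> S \<Longrightarrow> laminar S'"
  by (auto simp: laminar_def subset_iff)

lemma laminar_chain:
  assumes "laminar S" "Q \<in> S" "P \<in> S" "P' \<in> S" "Q \<subseteq> P" "Q \<subseteq> P'"
  shows "P \<subseteq> P' \<or> P' \<subseteq> P"
  using assms unfolding laminar_def by (metis Int_greatest subset_empty)

text \<open>If \<open>i\<close> does not decrease as sets shrink, these are the sets at which a value of \<open>i\<close> is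
  reached for the first time on the way down.\<close>

definition tops :: "'a set set \<Rightarrow> ('a set \<Rightarrow> int) \<Rightarrow> 'a set set" where
  "tops S i = {R \<in> S. \<forall>P\<in>S. R \<subset> P \<longrightarrow> i P \<noteq> i R}"

lemma tops_subset: "tops S i \<subseteq> S"
  by (auto simp: tops_def)

lemma tops_disjoint:
  assumes "laminar S" "R \<in> tops S i" "R' \<in> tops S i" "i R = i R'" "R \<noteq> R'"
  shows "R \<inter> R' = {}"
  using assms unfolding tops_def laminar_def by (metis (mono_tags, lifting) mem_Collect_eq psubsetI)

text \<open>Take \<open>R\<close> maximal among the sets above \<open>Q\<close> with the same two levels. If \<open>R\<close> were a top for
  neither level, there would be larger sets \<open>P\<close> and \<open>P'\<close> having the \<open>i\<close>-level and the
  \<open>j\<close>-level of \<open>R\<close> respectively. They are comparable, and by monotonicity the smaller one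
  shares both levels with \<open>R\<close>, contradicting maximality.\<close>

lemma ex_top_above:
  assumes "finite S" "laminar S" and i: "antimono_on S i" and j: "antimono_on S j" and Q: "Q \<in> S"
  shows "\<exists>R\<in>tops S i \<union> tops S j. Q \<subseteq> R \<and> i R = i Q \<and> j R = j Q"
proof -
  let ?X = "{R \<in> S. Q \<subseteq> R \<and> i R = i Q \<and> j R = j Q}"
  have "finite ?X" "?X \<noteq> {}" using assms(1) Q by auto
  from finite_has_maximal[OF this]
  obtain R where R: "R \<in> ?X" and max: "\<And>P. P \<in> ?X \<Longrightarrow> R \<subseteq> P \<Longrightarrow> P = R"
    by (metis (no_types, lifting))
  have "R \<in> tops S i \<union> tops S j"
  proof (rule ccontr)
    assume "\<not> ?thesis"
    then obtain P P' where P: "P \<in> S" "R \<subset> P" "i P = i R" and P': "P' \<in> S" "R \<subset> P'" "j P' = j R"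
      using R by (auto simp: tops_def)
    have iD: "i B \<le> i A" and jD: "j B \<le> j A" if "A \<in> S" "B \<in> S" "A \<subseteq> B" for A B
      using monotone_onD[OF i that] monotone_onD[OF j that] by auto
    have "P \<subseteq> P' \<or> P' \<subseteq> P"
      using laminar_chain[OF assms(2), of R P P'] R P P' by auto
    then show False
    proof
      assume "P \<subseteq> P'"
      then have "j P' \<le> j P" "j P \<le> j R" using jD[of P P'] jD[of R P] P P' R by auto
      then show False using max[of P] P P' R by auto
    next
      assume "P' \<subseteq> P"
      then have "i P \<le> i P'" "i P' \<le> i R" using iD[of P' P] iD[of R P'] P P' R by auto
      then show False using max[of P'] P P' R by auto
    qed
  qed
  then show ?thesis using R by auto
qed

text \<open>Distribute the sets among the tops above them: the factors \<open>A\<close> and \<open>B\<close> are constant on each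
  group, and the testing hypothesis sums \<open>T\<close> over it. With \<open>i = j\<close> this is the Carleson
  embedding.\<close>

lemma sum_le_sum_tops:
  fixes A B :: "int \<Rightarrow> real" and T \<tau> :: "'a set \<Rightarrow> real"
  assumes fin: "finite S" and lam: "laminar S" and i: "antimono_on S i" and j: "antimono_on S j"
    and AB: "\<And>k. 0 \<le> A k" "\<And>k. 0 \<le> B k" and T: "\<And>Q. Q \<in> S \<Longrightarrow> 0 \<le> T Q"
    and testing: "\<And>R. R \<in> S \<Longrightarrow> (\<Sum>Q\<in>{Q\<in>S. Q \<subseteq> R}. T Q) \<le> \<tau> R"
  shows "(\<Sum>Q\<in>S. A (i Q) * B (j Q) * T Q) \<le> (\<Sum>R\<in>tops S i \<union> tops S j. A (i R) * B (j R) * \<tau> R)"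
proof -
  let ?T = "tops S i \<union> tops S j"
  obtain \<rho> where \<rho>: "\<And>Q. Q \<in> S \<Longrightarrow> \<rho> Q \<in> ?T \<and> Q \<subseteq> \<rho> Q \<and> i (\<rho> Q) = i Q \<and> j (\<rho> Q) = j Q"
    using ex_top_above[OF fin lam i j] by metis
  have finT: "finite ?T" using fin tops_subset by (metis finite_Un finite_subset)
  have "(\<Sum>Q\<in>S. A (i Q) * B (j Q) * T Q) = (\<Sum>R\<in>?T. \<Sum>Q\<in>{Q\<in>S. \<rho> Q = R}. A (i Q) * B (j Q) * T Q)"
    using fin finT \<rho> by (intro sum.group[symmetric]) auto
  also have "\<dots> \<le> (\<Sum>R\<in>?T. A (i R) * B (j R) * \<tau> R)"
  proof (rule sum_mono)
    fix R assume R: "R \<in> ?T"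
    then have RS: "R \<in> S" using tops_subset by auto
    have "(\<Sum>Q\<in>{Q\<in>S. \<rho> Q = R}. A (i Q) * B (j Q) * T Q) = A (i R) * B (j R) * (\<Sum>Q\<in>{Q\<in>S. \<rho> Q = R}. T Q)"
      unfolding sum_distrib_left using \<rho> by (intro sum.cong) auto
    also have "(\<Sum>Q\<in>{Q\<in>S. \<rho> Q = R}. T Q) \<le> (\<Sum>Q\<in>{Q\<in>S. Q \<subseteq> R}. T Q)"
      using fin \<rho> T by (intro sum_mono2) auto
    also have "\<dots> \<le> \<tau> R" by (rule testing[OF RS])
    finally show "(\<Sum>Q\<in>{Q\<in>S. \<rho> Q = R}. A (i Q) * B (j Q) * T Q) \<le> A (i R) * B (j R) * \<tau> R"
      using AB by (simp add: mult_left_mono)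
  qed
  finally show ?thesis .
qed

text \<open>The smallest antitone majorant of \<open>\<phi>\<close> on the family; \<open>\<phi>\<close> itself has no monotonicity.\<close>

definition sup_over :: "'a set set \<Rightarrow> ('a set \<Rightarrow> real) \<Rightarrow> 'a set \<Rightarrow> real" where
  "sup_over S \<phi> Q = Max (\<phi> ` {R \<in> S. Q \<subseteq> R})"

definition level :: "'a set set \<Rightarrow> ('a set \<Rightarrow> real) \<Rightarrow> 'a set \<Rightarrow> int" where
  "level S \<phi> Q = \<lfloor>log 2 (sup_over S \<phi> Q)\<rfloor>"

lemma sup_over_ge:
  assumes "finite S" "Q \<in> S" shows "\<phi> Q \<le> sup_over S \<phi> Q"
  using assms by (auto simp: sup_over_def intro!: Max_ge)

lemma sup_over_antimono:
  assumes "finite S" "P \<in> S" "Q \<subseteq> P" shows "sup_over S \<phi> P \<le> sup_over S \<phi> Q"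
  unfolding sup_over_def using assms by (intro Max_mono) auto

lemma level_antimono:
  assumes "finite S" "\<And>Q. Q \<in> S \<Longrightarrow> 0 < \<phi> Q"
  shows "antimono_on S (level S \<phi>)"
proof (rule monotone_onI)
  fix Q P assume QP: "Q \<in> S" "P \<in> S" "Q \<subseteq> P"
  have "0 < sup_over S \<phi> P" "sup_over S \<phi> P \<le> sup_over S \<phi> Q"
    using QP assms sup_over_ge[OF assms(1), of P \<phi>] sup_over_antimono[OF assms(1)] by (auto intro: less_le_trans)
  then show "level S \<phi> P \<le> level S \<phi> Q"
    unfolding level_def by (intro floor_mono) auto
qed

lemma level_ge:
  assumes "finite S" "Q \<in> S" "0 < \<phi> Q" shows "\<phi> Q \<le> 2 * 2 powr level S \<phi> Q"
proof -
  have "0 < sup_over S \<phi> Q" using sup_over_ge[OF assms(1,2), of \<phi>] assms(3) by linarith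
  then have "sup_over S \<phi> Q = 2 powr log 2 (sup_over S \<phi> Q)" by simp
  also have "\<dots> \<le> 2 powr (1 + level S \<phi> Q)"
    unfolding level_def by (intro powr_mono) linarith+
  finally show ?thesis using sup_over_ge[OF assms(1,2), of \<phi>] by (simp add: powr_add)
qed

text \<open>The maximum over the sets above a top is attained at the top itself: a strictly larger set
  attaining it would have the same level.\<close>

lemma level_top_le:
  assumes "finite S" "R \<in> tops S (level S \<phi>)" and pos: "\<And>Q. Q \<in> S \<Longrightarrow> 0 < \<phi> Q"
  shows "2 powr level S \<phi> R \<le> \<phi> R"
proof -
  have RS: "R \<in> S" using assms tops_subset by auto
  have "sup_over S \<phi> R \<in> \<phi> ` {P \<in> S. R \<subseteq> P}"
    unfolding sup_over_def using assms RS by (intro Max_in) auto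
  then obtain P where P: "P \<in> S" "R \<subseteq> P" "sup_over S \<phi> R = \<phi> P" by auto
  have "sup_over S \<phi> P = sup_over S \<phi> R"
    using sup_over_antimono[OF assms(1) P(1,2), of \<phi>] sup_over_ge[OF assms(1) P(1), of \<phi>] P(3) by linarith
  then have "level S \<phi> P = level S \<phi> R" by (simp add: level_def)
  then have "P = R" using assms(2) P by (auto simp: tops_def)
  then have eq: "sup_over S \<phi> R = \<phi> R" using P by simp
  have "2 powr level S \<phi> R \<le> 2 powr log 2 (\<phi> R)"
    unfolding level_def eq by (intro powr_mono) auto
  then show ?thesis using pos[OF RS] by simp
qed

section \<open>Summation over sparse families\<close>

text \<open>Induction on the number of subsets. The maximal proper subsets \<open>C\<close> of \<open>R\<close> are disjoint and
  together have at most half of the \<open>m\<close>-mass of \<open>R\<close>, so Hoelder's inequality shows that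
  their terms add up to at most \<open>2\<^bsup>-z\<^esup>\<close> times the term of \<open>R\<close>. The constant is the sum of
  the resulting geometric series.\<close>

lemma sparse_sum_le:
  fixes U V m :: "'a set \<Rightarrow> real"
  assumes fin: "finite S" and lam: "laminar S"
    and pos: "\<And>Q. Q \<in> S \<Longrightarrow> 0 < U Q \<and> 0 < V Q \<and> 0 < m Q"
    and sup: "\<And>R C. R \<in> S \<Longrightarrow> C \<subseteq> {Q \<in> S. Q \<subset> R} \<Longrightarrow> disjoint C \<Longrightarrow>
               sum U C \<le> U R \<and> sum V C \<le> V R \<and> sum m C \<le> m R / 2"
    and xyz: "0 \<le> x" "0 \<le> y" "0 < z" "x + y + z = 1"
    and R: "R \<in> S"
  shows "(\<Sum>Q\<in>{Q\<in>S. Q \<subseteq> R}. U Q powr x * V Q powr y * m Q powr z)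
     \<le> 1 / (1 - 2 powr - z) * (U R powr x * V R powr y * m R powr z)"
  using R
proof (induction "card {Q \<in> S. Q \<subset> R}" arbitrary: R rule: less_induct)
  case less
  define t where "t Q = U Q powr x * V Q powr y * m Q powr z" for Q
  define q :: real where "q = 2 powr - z"
  have q: "0 < q" "q < 1" using xyz by (auto simp: q_def powr_less_one)
  define D where "D P = {Q \<in> S. Q \<subseteq> P}" for P
  define C where "C = {Q \<in> S. Q \<subset> R \<and> (\<forall>P\<in>S. P \<subset> R \<longrightarrow> \<not> Q \<subset> P)}"
  have CS: "C \<subseteq> {Q \<in> S. Q \<subset> R}" and finC: "finite C" using fin by (auto simp: C_def)
  have disjC: "disjoint C"
  proof (rule disjointI)
    fix P P' assume P: "P \<in> C" "P' \<in> C" "P \<noteq> P'"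
    then have "\<not> P \<subset> P'" "\<not> P' \<subset> P" by (auto simp: C_def)
    moreover have "P \<inter> P' = {} \<or> P \<subseteq> P' \<or> P' \<subseteq> P" using P lam by (auto simp: C_def laminar_def)
    ultimately show "P \<inter> P' = {}" using P(3) by blast
  qed
  \<comment> \<open>Every proper subset of \<open>R\<close> in the family lies below a child of \<open>R\<close>.\<close>
  have split: "D R = insert R (\<Union>P\<in>C. D P)"
  proof
    show "D R \<subseteq> insert R (\<Union>P\<in>C. D P)"
    proof
      fix Q assume Q: "Q \<in> D R"
      show "Q \<in> insert R (\<Union>P\<in>C. D P)"
      proof (cases "Q = R")
        case False
        let ?X = "{P \<in> S. Q \<subseteq> P \<and> P \<subset> R}"
        have "finite ?X" "?X \<noteq> {}" using fin Q False by (auto simp: D_def)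
        from finite_has_maximal[OF this] obtain P where P: "P \<in> ?X" "\<And>P'. P' \<in> ?X \<Longrightarrow> P \<subseteq> P' \<Longrightarrow> P = P'"
          by (metis (no_types, lifting))
        have "\<not> P \<subset> P'" if "P' \<in> S" "P' \<subset> R" for P'
          using P(1) P(2)[of P'] that by auto
        then have "P \<in> C" using P(1) by (auto simp: C_def)
        then show ?thesis using P Q by (auto simp: D_def)
      qed auto
    qed
  qed (use less.prems in \<open>auto simp: D_def C_def\<close>)
  have IH: "sum t (D P) \<le> 1 / (1 - q) * t P" if "P \<in> C" for P
  proof -
    have P: "P \<in> S" "P \<subset> R" using that by (auto simp: C_def)
    have "{Q \<in> S. Q \<subset> P} \<subset> {Q \<in> S. Q \<subset> R}" using P by auto
    then have "card {Q \<in> S. Q \<subset> P} < card {Q \<in> S. Q \<subset> R}" using fin by (intro psubset_card_mono) auto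
    from less.hyps[OF this P(1)] show ?thesis by (simp add: t_def D_def q_def)
  qed
  have finD: "finite (D P)" for P using fin by (simp add: D_def)
  have disjD: "D P \<inter> D P' = {}" if "P \<in> C" "P' \<in> C" "P \<noteq> P'" for P P'
  proof -
    have "P \<inter> P' = {}" using disjC that by (auto simp: disjoint_def)
    then have "Q = {}" if "Q \<in> D P" "Q \<in> D P'" for Q using that by (auto simp: D_def)
    then show ?thesis using lam by (auto simp: D_def laminar_def)
  qed
  have "sum t (D R) = t R + sum t (\<Union>P\<in>C. D P)"
    unfolding split using finC finD by (subst sum.insert) (auto simp: D_def C_def)
  also have "sum t (\<Union>P\<in>C. D P) = (\<Sum>P\<in>C. sum t (D P))"
    using finC finD disjD by (intro sum.UNION_disjoint) auto
  also have "\<dots> \<le> (\<Sum>P\<in>C. 1 / (1 - q) * t P)" by (rule sum_mono) (rule IH)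
  also have "\<dots> = 1 / (1 - q) * sum t C" by (simp add: sum_distrib_left)
  also have "sum t C \<le> U R powr x * V R powr y * (m R / 2) powr z"
    unfolding t_def using CS pos less.prems xyz sup[OF less.prems CS disjC]
    by (intro Hoelder3_sum) auto
  also have "\<dots> = q * t R"
    by (simp add: t_def q_def powr_divide powr_minus_divide)
  finally have "sum t (D R) \<le> t R + 1 / (1 - q) * (q * t R)"
    using q by (simp add: mult_left_mono divide_right_mono)
  also have "\<dots> = 1 / (1 - q) * t R" using q by (simp add: field_simps)
  finally show ?case by (simp add: t_def D_def q_def)
qed

section \<open>The bilinear embedding\<close>

text \<open>The tops for the level of \<open>\<phi>\<close> use the hypothesis on tops for \<open>U\<close> and the Carleson condition
  for \<open>V\<close>; for the tops of \<open>\<psi>\<close> the roles are exchanged. No set pays for both Carleson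
  constants, whence a sum and not a product.\<close>

lemma bilinear_embedding:
  fixes U V \<phi> \<psi> T :: "'a set \<Rightarrow> real" and p p' s t \<kappa> \<Lambda> \<Lambda>' X Y :: real
  assumes fin: "finite S" and lam: "laminar S"
    and pos: "\<And>Q. Q \<in> S \<Longrightarrow> 0 < U Q \<and> 0 < V Q \<and> 0 < \<phi> Q \<and> 0 < \<psi> Q \<and> 0 \<le> T Q"
    and pp: "0 < p" "0 < p'" "1 / p + 1 / p' = 1" and st: "0 < s" "0 < t" and "0 \<le> \<kappa>"
    and CarlU: "\<And>R. R \<in> S \<Longrightarrow> (\<Sum>Q\<in>{Q\<in>S. Q \<subseteq> R}. U Q) \<le> \<Lambda> * U R" and "0 \<le> \<Lambda>"
    and CarlV: "\<And>R. R \<in> S \<Longrightarrow> (\<Sum>Q\<in>{Q\<in>S. Q \<subseteq> R}. V Q) \<le> \<Lambda>' * V R" and "0 \<le> \<Lambda>'"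
    and testing: "\<And>R. R \<in> S \<Longrightarrow> (\<Sum>Q\<in>{Q\<in>S. Q \<subseteq> R}. T Q) \<le> \<kappa> * (U R powr (1 / p) * V R powr (1 / p'))"
    and topsU: "(\<Sum>R\<in>tops S (level S \<phi>). 2 powr (s * level S \<phi> R) * U R) \<le> X"
    and topsV: "(\<Sum>R\<in>tops S (level S \<psi>). 2 powr (t * level S \<psi> R) * V R) \<le> Y"
  shows "(\<Sum>Q\<in>S. \<phi> Q powr (s / p) * \<psi> Q powr (t / p') * T Q)
    \<le> 2 powr (s / p + t / p') * \<kappa> * (\<Lambda> powr (1 / p) + \<Lambda>' powr (1 / p')) * X powr (1 / p) * Y powr (1 / p')"
proof -
  define i where "i = level S \<phi>"
  define j where "j = level S \<psi>"
  have i: "antimono_on S i" and j: "antimono_on S j"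
    unfolding i_def j_def using fin pos by (auto intro!: level_antimono)
  have finT: "finite (tops S k)" for k using fin tops_subset by (rule finite_subset[rotated])
  \<comment> \<open>The Carleson embedding: all cubes are reduced to the tops of a single level.\<close>
  have allU: "(\<Sum>R\<in>S. 2 powr (s * i R) * U R) \<le> \<Lambda> * X"
  proof -
    have "(\<Sum>R\<in>S. 2 powr (s * i R) * 1 * U R) \<le> (\<Sum>R\<in>tops S i \<union> tops S i. 2 powr (s * i R) * 1 * (\<Lambda> * U R))"
      by (rule sum_le_sum_tops[OF fin lam i i, where B = "\<lambda>_. 1"]) (use pos CarlU in \<open>auto simp: less_imp_le\<close>)
    also have "\<dots> = \<Lambda> * (\<Sum>R\<in>tops S i. 2 powr (s * i R) * U R)"
      by (simp add: sum_distrib_left algebra_simps)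
    also have "\<dots> \<le> \<Lambda> * X" using topsU \<open>0 \<le> \<Lambda>\<close> unfolding i_def by (intro mult_left_mono)
    finally show ?thesis by simp
  qed
  have allV: "(\<Sum>R\<in>S. 2 powr (t * j R) * V R) \<le> \<Lambda>' * Y"
  proof -
    have "(\<Sum>R\<in>S. 2 powr (t * j R) * 1 * V R) \<le> (\<Sum>R\<in>tops S j \<union> tops S j. 2 powr (t * j R) * 1 * (\<Lambda>' * V R))"
      by (rule sum_le_sum_tops[OF fin lam j j, where B = "\<lambda>_. 1"]) (use pos CarlV in \<open>auto simp: less_imp_le\<close>)
    also have "\<dots> = \<Lambda>' * (\<Sum>R\<in>tops S j. 2 powr (t * j R) * V R)"
      by (simp add: sum_distrib_left algebra_simps)
    also have "\<dots> \<le> \<Lambda>' * Y" using topsV \<open>0 \<le> \<Lambda>'\<close> unfolding j_def by (intro mult_left_mono)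
    finally show ?thesis by simp
  qed
  define h where "h R = (2 powr (s * i R) * U R) powr (1 / p) * (2 powr (t * j R) * V R) powr (1 / p')" for R
  have h: "h R = 2 powr (s / p * i R) * 2 powr (t / p' * j R) * (U R powr (1 / p) * V R powr (1 / p'))" for R
    by (simp add: h_def powr_mult powr_powr)
  have posT: "0 < U R \<and> 0 < V R" if "R \<in> tops S k" for R k using that pos tops_subset by blast
  have X: "0 \<le> X"
    by (rule order_trans[OF sum_nonneg topsU]) (use posT in \<open>auto simp: less_imp_le\<close>)
  have Y: "0 \<le> Y"
    by (rule order_trans[OF sum_nonneg topsV]) (use posT in \<open>auto simp: less_imp_le\<close>)
  have subU: "(\<Sum>R\<in>tops S k. 2 powr (s * i R) * U R) \<le> \<Lambda> * X" for k
    by (rule order_trans[OF sum_mono2 allU]) (use fin pos tops_subset in \<open>auto simp: less_imp_le\<close>)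
  have subV: "(\<Sum>R\<in>tops S k. 2 powr (t * j R) * V R) \<le> \<Lambda>' * Y" for k
    by (rule order_trans[OF sum_mono2 allV]) (use fin pos tops_subset in \<open>auto simp: less_imp_le\<close>)
  have hi: "sum h (tops S i) \<le> X powr (1 / p) * (\<Lambda>' * Y) powr (1 / p')"
    unfolding h_def using posT topsU subV pp
    by (intro Hoelder_sum finT) (auto simp: i_def)
  have hj: "sum h (tops S j) \<le> (\<Lambda> * X) powr (1 / p) * Y powr (1 / p')"
    unfolding h_def using posT topsV subU pp
    by (intro Hoelder_sum finT) (auto simp: j_def)
  have "(\<Sum>Q\<in>S. \<phi> Q powr (s / p) * \<psi> Q powr (t / p') * T Q)
     \<le> (\<Sum>Q\<in>S. 2 powr (s / p + t / p') * (2 powr (s / p * i Q) * 2 powr (t / p' * j Q) * T Q))"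
  proof (rule sum_mono)
    fix Q assume Q: "Q \<in> S"
    have "\<phi> Q powr (s / p) \<le> (2 * 2 powr i Q) powr (s / p)"
      using Q pos level_ge[OF fin Q, of \<phi>] st pp unfolding i_def by (intro powr_mono2) (auto simp: less_imp_le)
    also have "\<dots> = 2 powr (s / p) * 2 powr (s / p * i Q)" by (simp add: powr_mult powr_powr mult.commute)
    finally have 1: "\<phi> Q powr (s / p) \<le> 2 powr (s / p) * 2 powr (s / p * i Q)" .
    have "\<psi> Q powr (t / p') \<le> (2 * 2 powr j Q) powr (t / p')"
      using Q pos level_ge[OF fin Q, of \<psi>] st pp unfolding j_def by (intro powr_mono2) (auto simp: less_imp_le)
    also have "\<dots> = 2 powr (t / p') * 2 powr (t / p' * j Q)" by (simp add: powr_mult powr_powr mult.commute)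
    finally have 2: "\<psi> Q powr (t / p') \<le> 2 powr (t / p') * 2 powr (t / p' * j Q)" .
    have "\<phi> Q powr (s / p) * \<psi> Q powr (t / p') * T Q
      \<le> (2 powr (s / p) * 2 powr (s / p * i Q)) * (2 powr (t / p') * 2 powr (t / p' * j Q)) * T Q"
      using pos[OF Q] by (intro mult_right_mono mult_mono 1 2) auto
    then show "\<phi> Q powr (s / p) * \<psi> Q powr (t / p') * T Q
      \<le> 2 powr (s / p + t / p') * (2 powr (s / p * i Q) * 2 powr (t / p' * j Q) * T Q)"
      by (simp add: powr_add mult_ac)
  qed
  also have "\<dots> = 2 powr (s / p + t / p') * (\<Sum>Q\<in>S. 2 powr (s / p * i Q) * 2 powr (t / p' * j Q) * T Q)"
    by (simp add: sum_distrib_left)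
  also have "(\<Sum>Q\<in>S. 2 powr (s / p * i Q) * 2 powr (t / p' * j Q) * T Q)
     \<le> (\<Sum>R\<in>tops S i \<union> tops S j. 2 powr (s / p * i R) * 2 powr (t / p' * j R) * (\<kappa> * (U R powr (1 / p) * V R powr (1 / p'))))"
    by (rule sum_le_sum_tops[OF fin lam i j]) (use pos testing in auto)
  also have "\<dots> = \<kappa> * sum h (tops S i \<union> tops S j)"
    by (simp add: h sum_distrib_left mult_ac)
  also have "sum h (tops S i \<union> tops S j) \<le> sum h (tops S i) + sum h (tops S j)"
    using sum.union_inter[OF finT finT, of h i j] sum_nonneg[of "tops S i \<inter> tops S j" h] by (simp add: h)
  also have "\<dots> \<le> X powr (1 / p) * (\<Lambda>' * Y) powr (1 / p') + (\<Lambda> * X) powr (1 / p) * Y powr (1 / p')"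
    by (intro add_mono hi hj)
  also have "\<dots> = (\<Lambda> powr (1 / p) + \<Lambda>' powr (1 / p')) * (X powr (1 / p) * Y powr (1 / p'))"
    by (simp add: powr_mult algebra_simps)
  finally show ?thesis using \<open>0 \<le> \<kappa>\<close> by (simp add: mult_left_mono mult.assoc)
qed

section \<open>Strata of the joint weight condition\<close>

text \<open>The parameter \<open>\<eta>\<close> trades a power of the \<open>A\<^sub>r\<close> quantity for a positive power of \<open>m\<close>, which is
  what sparseness can exploit.\<close>

lemma stratum_exponents:
  fixes U V m :: real
  assumes pos: "0 < U" "0 < V" "0 < m" and pp: "1 / p + 1 / p' = 1"
  shows "(U / m) powr (1 / p + g * \<rho>) * (V / m) powr (1 / p' + g) * m
    = (V / m * (U / m) powr \<rho>) powr (g + \<eta>) *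
        (U powr (1 / p - \<eta> * \<rho>) * V powr (1 / p' - \<eta>) * m powr (\<eta> * (1 + \<rho>)))"
    and "U powr (1 / p - \<eta> * \<rho>) * V powr (1 / p' - \<eta>) * m powr (\<eta> * (1 + \<rho>))
     = (V / m * (U / m) powr \<rho>) powr (- \<eta>) * (U powr (1 / p) * V powr (1 / p'))"
proof -
  define i j where "i = 1 / p" and "j = 1 / p'"
  have j: "j = 1 - i" using pp by (simp add: i_def j_def)
  have m: "m = m powr 1" using pos by simp
  have "(U / m) powr (i + g * \<rho>) * (V / m) powr (j + g) * m powr 1
    = (V / m * (U / m) powr \<rho>) powr (g + \<eta>) *
        (U powr (i - \<eta> * \<rho>) * V powr (j - \<eta>) * m powr (\<eta> * (1 + \<rho>)))"
    using pos
    by (simp add: powr_def ln_mult ln_div mult_exp_exp j del: exp_ln) (simp add: algebra_simps)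
  then show "(U / m) powr (1 / p + g * \<rho>) * (V / m) powr (1 / p' + g) * m
    = (V / m * (U / m) powr \<rho>) powr (g + \<eta>) *
        (U powr (1 / p - \<eta> * \<rho>) * V powr (1 / p' - \<eta>) * m powr (\<eta> * (1 + \<rho>)))"
    using pos by (simp add: i_def j_def)
  have "U powr (i - \<eta> * \<rho>) * V powr (j - \<eta>) * m powr (\<eta> * (1 + \<rho>))
     = (V / m * (U / m) powr \<rho>) powr (- \<eta>) * (U powr i * V powr j)"
    using pos
    by (simp add: powr_def ln_mult ln_div mult_exp_exp del: exp_ln) (simp add: algebra_simps)
  then show "U powr (1 / p - \<eta> * \<rho>) * V powr (1 / p' - \<eta>) * m powr (\<eta> * (1 + \<rho>))
     = (V / m * (U / m) powr \<rho>) powr (- \<eta>) * (U powr (1 / p) * V powr (1 / p'))"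
    by (simp add: i_def j_def)
qed

text \<open>The choice of \<open>\<eta>\<close> keeps the exponents \<open>1/p - \<eta> \<rho>\<close> and \<open>1/p' - \<eta>\<close> nonnegative while the
  exponent \<open>\<eta> (1 + \<rho>)\<close> of the measure stays positive.\<close>

definition stratum_const :: "real \<Rightarrow> real \<Rightarrow> real \<Rightarrow> real \<Rightarrow> real" where
  "stratum_const p p' g \<rho> =
     (let \<eta> = min (1 / p') (1 / (p * \<rho>)) / 2 in 2 powr (g + \<eta>) / (1 - 2 powr - (\<eta> * (1 + \<rho>))))"

lemma stratum_const_nonneg:
  assumes "0 < p" "0 < p'" "0 < \<rho>" shows "0 \<le> stratum_const p p' g \<rho>"
proof -
  have "0 < min (1 / p') (1 / (p * \<rho>)) / 2 * (1 + \<rho>)" using assms by simp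
  from powr_less_one[of 2 "- (min (1 / p') (1 / (p * \<rho>)) / 2 * (1 + \<rho>))"] this
  show ?thesis unfolding stratum_const_def Let_def by (intro divide_nonneg_nonneg) auto
qed

text \<open>The \<open>A\<^sub>r\<close> quantity varies by a factor of at most two on the family, so its powers can be
  taken out of the sum from above and put back at \<open>R\<close> from below; what remains has exponents
  adding up to one, with a positive one on \<open>m\<close>.\<close>

lemma stratum_testing:
  fixes U V m :: "'a set \<Rightarrow> real" and p p' g \<rho> c :: real
  assumes fin: "finite S" and lam: "laminar S"
    and pos: "\<And>Q. Q \<in> S \<Longrightarrow> 0 < U Q \<and> 0 < V Q \<and> 0 < m Q"
    and sup: "\<And>R C. R \<in> S \<Longrightarrow> C \<subseteq> {Q \<in> S. Q \<subset> R} \<Longrightarrow> disjoint C \<Longrightarrow>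
               sum U C \<le> U R \<and> sum V C \<le> V R \<and> sum m C \<le> m R / 2"
    and pp: "0 < p" "0 < p'" "1 / p + 1 / p' = 1" and "0 < \<rho>" "0 < g" "0 < c"
    and stratum: "\<And>Q. Q \<in> S \<Longrightarrow> c \<le> V Q / m Q * (U Q / m Q) powr \<rho> \<and> V Q / m Q * (U Q / m Q) powr \<rho> \<le> 2 * c"
    and R: "R \<in> S"
  shows "(\<Sum>Q\<in>{Q\<in>S. Q \<subseteq> R}. (U Q / m Q) powr (1 / p + g * \<rho>) * (V Q / m Q) powr (1 / p' + g) * m Q)
     \<le> stratum_const p p' g \<rho> * c powr g * (U R powr (1 / p) * V R powr (1 / p'))"
proof -
  define \<eta> where "\<eta> = min (1 / p') (1 / (p * \<rho>)) / 2"
  define x where "x = 1 / p - \<eta> * \<rho>"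
  define y where "y = 1 / p' - \<eta>"
  define z where "z = \<eta> * (1 + \<rho>)"
  define A where "A Q = V Q / m Q * (U Q / m Q) powr \<rho>" for Q
  have "0 < \<eta>" using pp \<open>0 < \<rho>\<close> by (simp add: \<eta>_def)
  have "2 * \<eta> \<le> 1 / p'" "2 * \<eta> \<le> 1 / (p * \<rho>)" by (simp_all add: \<eta>_def)
  then have "\<eta> \<le> 1 / p'" "\<eta> \<le> 1 / (p * \<rho>)" using \<open>0 < \<eta>\<close> by linarith+
  then have "\<eta> * \<rho> \<le> 1 / p" using pp \<open>0 < \<rho>\<close> by (simp add: field_simps)
  then have xyz: "0 \<le> x" "0 \<le> y" "0 < z" "x + y + z = 1"
    using \<open>\<eta> \<le> 1 / p'\<close> \<open>0 < \<eta>\<close> \<open>0 < \<rho>\<close> pp by (auto simp: x_def y_def z_def algebra_simps add_pos_pos)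
  have z1: "2 powr - z < 1" using xyz by (simp add: powr_less_one)
  have A: "c \<le> A Q" "A Q \<le> 2 * c" "0 < A Q" if "Q \<in> S" for Q
    using stratum[OF that] \<open>0 < c\<close> by (auto simp: A_def)
  have "(\<Sum>Q\<in>{Q\<in>S. Q \<subseteq> R}. (U Q / m Q) powr (1 / p + g * \<rho>) * (V Q / m Q) powr (1 / p' + g) * m Q)
     \<le> (\<Sum>Q\<in>{Q\<in>S. Q \<subseteq> R}. (2 * c) powr (g + \<eta>) * (U Q powr x * V Q powr y * m Q powr z))"
  proof (rule sum_mono)
    fix Q assume "Q \<in> {Q\<in>S. Q \<subseteq> R}"
    then have Q: "Q \<in> S" by auto
    have "A Q powr (g + \<eta>) \<le> (2 * c) powr (g + \<eta>)"
      using A[OF Q] \<open>0 < g\<close> \<open>0 < \<eta>\<close> by (intro powr_mono2) auto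
    then show "(U Q / m Q) powr (1 / p + g * \<rho>) * (V Q / m Q) powr (1 / p' + g) * m Q
       \<le> (2 * c) powr (g + \<eta>) * (U Q powr x * V Q powr y * m Q powr z)"
      using pos[OF Q] stratum_exponents(1)[of "U Q" "V Q" "m Q" p p' g \<rho> \<eta>] pp
      by (simp add: A_def x_def y_def z_def mult_right_mono)
  qed
  also have "\<dots> = (2 * c) powr (g + \<eta>) * (\<Sum>Q\<in>{Q\<in>S. Q \<subseteq> R}. U Q powr x * V Q powr y * m Q powr z)"
    by (simp add: sum_distrib_left)
  also have "(\<Sum>Q\<in>{Q\<in>S. Q \<subseteq> R}. U Q powr x * V Q powr y * m Q powr z)
     \<le> 1 / (1 - 2 powr - z) * (U R powr x * V R powr y * m R powr z)"
    by (rule sparse_sum_le[OF fin lam pos sup xyz R])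
  also have "U R powr x * V R powr y * m R powr z = A R powr - \<eta> * (U R powr (1 / p) * V R powr (1 / p'))"
    using pos[OF R] pp unfolding A_def x_def y_def z_def by (intro stratum_exponents(2)) auto
  also have "A R powr - \<eta> \<le> c powr - \<eta>"
    using A[OF R] \<open>0 < c\<close> \<open>0 < \<eta>\<close> by (intro powr_mono2') auto
  finally have "(\<Sum>Q\<in>{Q\<in>S. Q \<subseteq> R}. (U Q / m Q) powr (1 / p + g * \<rho>) * (V Q / m Q) powr (1 / p' + g) * m Q)
     \<le> (2 * c) powr (g + \<eta>) * (1 / (1 - 2 powr - z) * (c powr - \<eta> * (U R powr (1 / p) * V R powr (1 / p'))))"
    using z1 by (simp add: mult_left_mono mult_right_mono divide_right_mono)
  also have "\<dots> = 2 powr (g + \<eta>) / (1 - 2 powr - z) * (c powr (g + \<eta>) * c powr - \<eta>) * (U R powr (1 / p) * V R powr (1 / p'))"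
    using \<open>0 < c\<close> by (simp add: powr_mult)
  also have "c powr (g + \<eta>) * c powr - \<eta> = c powr g"
    by (simp add: powr_add[symmetric])
  finally show ?thesis by (simp add: stratum_const_def Let_def \<eta>_def z_def)
qed

text \<open>The numbers \<open>U\<close>, \<open>V\<close>, \<open>m\<close> stand for the masses of \<open>u\<close>, \<open>v\<close> and the underlying measure, and
  \<open>\<phi>\<close>, \<open>\<psi>\<close> for the averages with respect to \<open>u\<close> and \<open>v\<close>. Each stratum satisfies the
  hypotheses of the bilinear embedding with a testing constant that is a power of the size
  of the stratum, and these powers sum geometrically.\<close>

lemma sparse_form_le:
  fixes U V m \<phi> \<psi> :: "'a set \<Rightarrow> real" and p p' g \<rho> A X Y \<Lambda> \<Lambda>' :: real
  assumes fin: "finite S" and lam: "laminar S"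
    and pos: "\<And>Q. Q \<in> S \<Longrightarrow> 0 < U Q \<and> 0 < V Q \<and> 0 < m Q"
    and sup: "\<And>R C. R \<in> S \<Longrightarrow> C \<subseteq> {Q \<in> S. Q \<subset> R} \<Longrightarrow> disjoint C \<Longrightarrow>
               sum U C \<le> U R \<and> sum V C \<le> V R \<and> sum m C \<le> m R / 2"
    and pp: "0 < p" "0 < p'" "1 / p + 1 / p' = 1" and \<rho>: "0 < \<rho>" and g: "0 < g"
    and A: "\<And>Q. Q \<in> S \<Longrightarrow> V Q / m Q * (U Q / m Q) powr \<rho> \<le> A" "0 < A"
    and nonneg: "\<And>Q. Q \<in> S \<Longrightarrow> 0 \<le> \<phi> Q \<and> 0 \<le> \<psi> Q"
    and CarlU: "\<And>R. R \<in> S \<Longrightarrow> (\<Sum>Q\<in>{Q\<in>S. Q \<subseteq> R}. U Q) \<le> \<Lambda> * U R" "0 \<le> \<Lambda>"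
    and CarlV: "\<And>R. R \<in> S \<Longrightarrow> (\<Sum>Q\<in>{Q\<in>S. Q \<subseteq> R}. V Q) \<le> \<Lambda>' * V R" "0 \<le> \<Lambda>'"
    and topsU: "\<And>S'. S' \<subseteq> S \<Longrightarrow> (\<And>Q. Q \<in> S' \<Longrightarrow> 0 < \<phi> Q) \<Longrightarrow>
       (\<Sum>R\<in>tops S' (level S' \<phi>). 2 powr (p * (1 / p + g * \<rho>) * level S' \<phi> R) * U R) \<le> X"
    and topsV: "\<And>S'. S' \<subseteq> S \<Longrightarrow> (\<And>Q. Q \<in> S' \<Longrightarrow> 0 < \<psi> Q) \<Longrightarrow>
       (\<Sum>R\<in>tops S' (level S' \<psi>). 2 powr (p' * (1 / p' + g) * level S' \<psi> R) * V R) \<le> Y"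
  shows "(\<Sum>Q\<in>S. (\<phi> Q * (U Q / m Q)) powr (1 / p + g * \<rho>) * (\<psi> Q * (V Q / m Q)) powr (1 / p' + g) * m Q)
    \<le> 2 powr (1 / p + g * \<rho> + (1 / p' + g)) * stratum_const p p' g \<rho> / (1 - 2 powr - g)
       * A powr g * (\<Lambda> powr (1 / p) + \<Lambda>' powr (1 / p')) * X powr (1 / p) * Y powr (1 / p')"
proof -
  define \<alpha> where "\<alpha> = 1 / p + g * \<rho>"
  define \<beta> where "\<beta> = 1 / p' + g"
  have \<alpha>\<beta>: "0 < \<alpha>" "0 < \<beta>" using pp \<rho> g by (auto simp: \<alpha>_def \<beta>_def add_pos_pos)
  define Aq where "Aq Q = V Q / m Q * (U Q / m Q) powr \<rho>" for Q
  define k where "k Q = \<lfloor>log 2 (Aq Q)\<rfloor>" for Q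
  define T where "T Q = (U Q / m Q) powr \<alpha> * (V Q / m Q) powr \<beta> * m Q" for Q
  \<comment> \<open>Levels are logarithms, so the terms with a vanishing average are removed first.\<close>
  define S' where "S' = {Q \<in> S. 0 < \<phi> Q \<and> 0 < \<psi> Q}"
  define St where "St n = {Q \<in> S'. k Q = n}" for n
  define K where "K = 2 powr (\<alpha> + \<beta>) * stratum_const p p' g \<rho> *
      (\<Lambda> powr (1 / p) + \<Lambda>' powr (1 / p')) * X powr (1 / p) * Y powr (1 / p')"
  have K: "0 \<le> K" using stratum_const_nonneg[OF pp(1,2) \<rho>] by (auto simp: K_def)
  have finS': "finite S'" and S'S: "S' \<subseteq> S" using fin by (auto simp: S'_def)
  have Aq: "0 < Aq Q" if "Q \<in> S" for Q using pos[OF that] by (simp add: Aq_def)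
  have k: "2 powr k Q \<le> Aq Q" "Aq Q \<le> 2 * 2 powr k Q" if "Q \<in> S" for Q
  proof -
    have eq: "Aq Q = 2 powr log 2 (Aq Q)" using Aq[OF that] by simp
    show "2 powr k Q \<le> Aq Q" by (subst eq) (auto simp: k_def intro!: powr_mono)
    have "2 powr log 2 (Aq Q) \<le> 2 powr (1 + k Q)" unfolding k_def by (intro powr_mono) linarith+
    then show "Aq Q \<le> 2 * 2 powr k Q" using eq by (simp add: powr_add)
  qed
  have one: "(\<Sum>Q\<in>St n. \<phi> Q powr \<alpha> * \<psi> Q powr \<beta> * T Q) \<le> K * 2 powr (g * n)" for n
  proof -
    have sub: "St n \<subseteq> S" and posSt: "\<And>Q. Q \<in> St n \<Longrightarrow> 0 < \<phi> Q \<and> 0 < \<psi> Q"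
      by (auto simp: St_def S'_def)
    have finSt: "finite (St n)" using sub fin by (rule finite_subset)
    have lamSt: "laminar (St n)" using lam sub by (rule laminar_subset)
    have test: "(\<Sum>Q\<in>{Q\<in>St n. Q \<subseteq> R}. T Q)
       \<le> stratum_const p p' g \<rho> * (2 powr n) powr g * (U R powr (1 / p) * V R powr (1 / p'))" if "R \<in> St n" for R
      unfolding T_def \<alpha>_def \<beta>_def
    proof (rule stratum_testing[OF finSt lamSt _ _ pp \<rho> g _ _ that])
      fix R C assume "R \<in> St n" "C \<subseteq> {Q \<in> St n. Q \<subset> R}" "disjoint C"
      then show "sum U C \<le> U R \<and> sum V C \<le> V R \<and> sum m C \<le> m R / 2"
        using sub by (intro sup) auto
    next
      fix Q assume "Q \<in> St n"
      then have "Q \<in> S" "k Q = n" by (auto simp: St_def S'_def)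
      then show "2 powr n \<le> V Q / m Q * (U Q / m Q) powr \<rho> \<and> V Q / m Q * (U Q / m Q) powr \<rho> \<le> 2 * 2 powr n"
        using k[of Q] by (simp add: Aq_def)
    qed (use sub pos in auto)
    have Carl: "(\<Sum>Q\<in>{Q\<in>St n. Q \<subseteq> R}. U Q) \<le> \<Lambda> * U R" "(\<Sum>Q\<in>{Q\<in>St n. Q \<subseteq> R}. V Q) \<le> \<Lambda>' * V R"
      if "R \<in> St n" for R
    proof -
      have R: "R \<in> S" using that sub by auto
      show "(\<Sum>Q\<in>{Q\<in>St n. Q \<subseteq> R}. U Q) \<le> \<Lambda> * U R"
        by (rule order_trans[OF sum_mono2 CarlU(1)[OF R]]) (use fin sub pos in \<open>auto simp: less_imp_le\<close>)
      show "(\<Sum>Q\<in>{Q\<in>St n. Q \<subseteq> R}. V Q) \<le> \<Lambda>' * V R"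
        by (rule order_trans[OF sum_mono2 CarlV(1)[OF R]]) (use fin sub pos in \<open>auto simp: less_imp_le\<close>)
    qed
    have posT: "0 \<le> T Q" if "Q \<in> S" for Q using pos[OF that] by (simp add: T_def)
    have "(\<Sum>Q\<in>St n. \<phi> Q powr (p * \<alpha> / p) * \<psi> Q powr (p' * \<beta> / p') * T Q)
     \<le> 2 powr (p * \<alpha> / p + p' * \<beta> / p') * (stratum_const p p' g \<rho> * (2 powr n) powr g)
        * (\<Lambda> powr (1 / p) + \<Lambda>' powr (1 / p')) * X powr (1 / p) * Y powr (1 / p')"
      by (rule bilinear_embedding[OF finSt lamSt _ pp])
        (use pos posSt posT sub \<alpha>\<beta> pp test Carl CarlU(2) CarlV(2) stratum_const_nonneg[OF pp(1,2) \<rho>, of g]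
           topsU[OF sub] topsV[OF sub] in \<open>auto simp: \<alpha>_def[symmetric] \<beta>_def[symmetric]\<close>)
    then show ?thesis using pp by (simp add: K_def powr_powr mult_ac)
  qed
  have geo: "(\<Sum>n\<in>k ` S'. 2 powr (g * real_of_int n)) \<le> A powr g / (1 - 2 powr - g)"
  proof (rule sum_powers_of_two_le)
    fix n assume "n \<in> k ` S'"
    then obtain Q where "Q \<in> S" "n = k Q" using S'S by auto
    then show "2 powr real_of_int n \<le> A" using k(1)[of Q] A(1)[of Q] by (simp add: Aq_def)
  qed (use finS' g A in auto)
  have "(\<Sum>Q\<in>S. (\<phi> Q * (U Q / m Q)) powr \<alpha> * (\<psi> Q * (V Q / m Q)) powr \<beta> * m Q)
     = (\<Sum>Q\<in>S. \<phi> Q powr \<alpha> * \<psi> Q powr \<beta> * T Q)"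
    unfolding T_def powr_mult by (simp only: mult_ac)
  also have "\<dots> = (\<Sum>Q\<in>S'. \<phi> Q powr \<alpha> * \<psi> Q powr \<beta> * T Q)"
  proof (rule sum.mono_neutral_right[OF fin S'S], rule ballI)
    fix Q assume "Q \<in> S - S'"
    then have "\<phi> Q = 0 \<or> \<psi> Q = 0" using nonneg[of Q] by (auto simp: S'_def)
    then show "\<phi> Q powr \<alpha> * \<psi> Q powr \<beta> * T Q = 0" by auto
  qed
  also have "\<dots> = (\<Sum>n\<in>k ` S'. \<Sum>Q\<in>St n. \<phi> Q powr \<alpha> * \<psi> Q powr \<beta> * T Q)"
    unfolding St_def using finS' by (intro sum.group[symmetric]) auto
  also have "\<dots> \<le> (\<Sum>n\<in>k ` S'. K * 2 powr (g * n))" by (intro sum_mono one)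
  also have "\<dots> = K * (\<Sum>n\<in>k ` S'. 2 powr (g * n))" by (simp add: sum_distrib_left)
  also have "\<dots> \<le> K * (A powr g / (1 - 2 powr - g))" by (intro mult_left_mono geo K)
  finally show ?thesis unfolding \<alpha>_def[symmetric] \<beta>_def[symmetric] K_def by (simp add: mult_ac)
qed

section \<open>Doob's inequality on the tops\<close>

text \<open>The part of \<open>F\<close> that does not exceed \<open>l\<close> contributes at most \<open>l\<close> to the average.\<close>

lemma weak_type_truncated:
  fixes F :: "'a \<Rightarrow> real"
  assumes F: "F \<in> borel_measurable \<nu>" and R: "R \<in> sets \<nu>" "emeasure \<nu> R < \<infinity>" and "0 < l"
    and avg: "ennreal (2 * l) * emeasure \<nu> R \<le> (\<integral>\<^sup>+x\<in>R. F x \<partial>\<nu>)"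
  shows "ennreal l * emeasure \<nu> R \<le> (\<integral>\<^sup>+x\<in>R. ennreal (F x) * indicator {x. l < F x} x \<partial>\<nu>)"
proof -
  have "(\<integral>\<^sup>+x\<in>R. F x \<partial>\<nu>)
     \<le> (\<integral>\<^sup>+x. ennreal (F x) * indicator {x. l < F x} x * indicator R x + ennreal l * indicator R x \<partial>\<nu>)"
    by (intro nn_integral_mono) (auto simp: indicator_def ennreal_leI split: if_splits)
  also have "\<dots> = (\<integral>\<^sup>+x\<in>R. ennreal (F x) * indicator {x. l < F x} x \<partial>\<nu>) + ennreal l * emeasure \<nu> R"
    using F R by (subst nn_integral_add) (auto simp: nn_integral_cmult_indicator)
  finally have le: "(\<integral>\<^sup>+x\<in>R. F x \<partial>\<nu>)
     \<le> (\<integral>\<^sup>+x\<in>R. ennreal (F x) * indicator {x. l < F x} x \<partial>\<nu>) + ennreal l * emeasure \<nu> R" .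
  have "ennreal (2 * l) = ennreal l + ennreal l"
    using \<open>0 < l\<close> by (subst ennreal_plus[symmetric]) auto
  then have "ennreal l * emeasure \<nu> R + ennreal l * emeasure \<nu> R
     \<le> (\<integral>\<^sup>+x\<in>R. ennreal (F x) * indicator {x. l < F x} x \<partial>\<nu>) + ennreal l * emeasure \<nu> R"
    using order_trans[OF avg le] by (simp only: distrib_right)
  moreover have "ennreal l * emeasure \<nu> R \<noteq> top"
    using R by (auto simp: ennreal_mult_eq_top_iff)
  ultimately show ?thesis by (simp add: ennreal_add_left_cancel_le add.commute)
qed

definition doob_const :: "real \<Rightarrow> real" where
  "doob_const s = 2 * 2 powr (s - 1) / (1 - 2 powr - (s - 1))"

text \<open>Apply the truncated weak-type estimate on each \<open>R\<close> and exchange sum and integral. At a fixed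
  point the sets that contain it have distinct levels, and only levels with \<open>2\<^sup>i < 2 F\<close>
  survive the truncation, so a geometric series gives \<open>F\<^sup>s\<close>.\<close>

lemma doob_tops:
  fixes F :: "'a \<Rightarrow> real" and i :: "'a set \<Rightarrow> int" and s :: real
  assumes T: "finite T" "T \<subseteq> sets \<nu>" "\<And>R. R \<in> T \<Longrightarrow> emeasure \<nu> R < \<infinity>"
    and disj: "\<And>R R'. R \<in> T \<Longrightarrow> R' \<in> T \<Longrightarrow> i R = i R' \<Longrightarrow> R \<noteq> R' \<Longrightarrow> R \<inter> R' = {}"
    and F: "F \<in> borel_measurable \<nu>" "\<And>x. 0 \<le> F x" and s: "1 < s"
    and avg: "\<And>R. R \<in> T \<Longrightarrow> ennreal (2 powr i R) * emeasure \<nu> R \<le> (\<integral>\<^sup>+x\<in>R. F x \<partial>\<nu>)"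
  shows "(\<Sum>R\<in>T. ennreal (2 powr (s * i R)) * emeasure \<nu> R) \<le> ennreal (doob_const s) * (\<integral>\<^sup>+x. F x powr s \<partial>\<nu>)"
proof -
  define l :: "'a set \<Rightarrow> real" where "l R = 2 powr i R / 2" for R
  define G where "G x R = 2 * 2 powr ((s - 1) * i R) * F x * indicator {x. l R < F x} x * indicator R x" for x R
  have each: "ennreal (2 powr (s * i R)) * emeasure \<nu> R \<le> (\<integral>\<^sup>+x. ennreal (G x R) \<partial>\<nu>)" if R: "R \<in> T" for R
  proof -
    have "ennreal (l R) * emeasure \<nu> R \<le> (\<integral>\<^sup>+x\<in>R. ennreal (F x) * indicator {x. l R < F x} x \<partial>\<nu>)"
      using R T F avg[OF R] by (intro weak_type_truncated) (auto simp: l_def)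
    then have "ennreal (2 * 2 powr ((s - 1) * i R)) * (ennreal (l R) * emeasure \<nu> R)
      \<le> ennreal (2 * 2 powr ((s - 1) * i R)) * (\<integral>\<^sup>+x\<in>R. ennreal (F x) * indicator {x. l R < F x} x \<partial>\<nu>)"
      by (rule mult_left_mono) auto
    also have "\<dots> = (\<integral>\<^sup>+x. ennreal (2 * 2 powr ((s - 1) * i R)) * (ennreal (F x) * indicator {x. l R < F x} x * indicator R x) \<partial>\<nu>)"
      using F R T by (intro nn_integral_cmult[symmetric]) auto
    also have "\<dots> = (\<integral>\<^sup>+x. ennreal (G x R) \<partial>\<nu>)"
      using F by (intro nn_integral_cong) (auto simp: G_def indicator_def ennreal_mult)
    also have "ennreal (2 * 2 powr ((s - 1) * i R)) * (ennreal (l R) * emeasure \<nu> R)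
      = ennreal (2 * 2 powr ((s - 1) * i R) * l R) * emeasure \<nu> R"
      by (subst ennreal_mult) (auto simp only: mult.assoc l_def, auto)
    also have "2 * 2 powr ((s - 1) * i R) * l R = 2 powr (s * i R)"
      by (simp add: l_def powr_add[symmetric] algebra_simps)
    finally show ?thesis .
  qed
  \<comment> \<open>Disjointness on each level makes the levels of the sets containing \<open>x\<close> distinct.\<close>
  have ptw: "(\<Sum>R\<in>T. G x R) \<le> doob_const s * F x powr s" for x
  proof (cases "F x = 0")
    case True
    then show ?thesis by (simp add: G_def)
  next
    case False
    then have Fx: "0 < F x" using F(2)[of x] by simp
    define Tx where "Tx = {R \<in> T. x \<in> R \<and> l R < F x}"
    have inj: "inj_on i Tx"
      using disj unfolding inj_on_def Tx_def by blast
    have "(\<Sum>R\<in>T. G x R) = (\<Sum>R\<in>Tx. 2 * F x * 2 powr ((s - 1) * i R))"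
      unfolding Tx_def using T(1) by (intro sum.mono_neutral_cong_right) (auto simp: G_def indicator_def)
    also have "\<dots> = 2 * F x * (\<Sum>k\<in>i ` Tx. 2 powr ((s - 1) * real_of_int k))"
      by (simp add: sum.reindex[OF inj] sum_distrib_left)
    also have "(\<Sum>k\<in>i ` Tx. 2 powr ((s - 1) * real_of_int k)) \<le> (2 * F x) powr (s - 1) / (1 - 2 powr - (s - 1))"
      using T(1) s Fx by (intro sum_powers_of_two_le) (auto simp: Tx_def l_def)
    also have "2 * F x * ((2 * F x) powr (s - 1) / (1 - 2 powr - (s - 1))) = doob_const s * (F x powr 1 * F x powr (s - 1))"
      using Fx by (simp add: doob_const_def powr_mult)
    also have "F x powr 1 * F x powr (s - 1) = F x powr s" using powr_add[of "F x" 1 "s - 1"] by simp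
    finally show ?thesis using Fx by (simp add: mult_left_mono)
  qed
  have Gm: "(\<lambda>x. G x R) \<in> borel_measurable \<nu>" if "R \<in> T" for R
  proof -
    note [measurable] = F(1)
    have [measurable]: "R \<in> sets \<nu>" using that T by auto
    show ?thesis unfolding G_def by measurable
  qed
  have G0: "0 \<le> G x R" for x R using F by (simp add: G_def)
  have C0: "0 \<le> doob_const s" using s by (auto simp: doob_const_def intro!: divide_nonneg_nonneg less_imp_le[OF powr_less_one])
  have "(\<Sum>R\<in>T. ennreal (2 powr (s * i R)) * emeasure \<nu> R) \<le> (\<Sum>R\<in>T. \<integral>\<^sup>+x. ennreal (G x R) \<partial>\<nu>)"
    by (intro sum_mono each)
  also have "\<dots> = (\<integral>\<^sup>+x. (\<Sum>R\<in>T. ennreal (G x R)) \<partial>\<nu>)"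
    using Gm by (intro nn_integral_sum[symmetric]) auto
  also have "\<dots> = (\<integral>\<^sup>+x. ennreal (\<Sum>R\<in>T. G x R) \<partial>\<nu>)" using G0 by simp
  also have "\<dots> \<le> (\<integral>\<^sup>+x. ennreal (doob_const s) * ennreal (F x powr s) \<partial>\<nu>)"
    using ptw C0 by (intro nn_integral_mono) (auto simp: ennreal_mult[symmetric] intro!: ennreal_leI)
  also have "\<dots> = ennreal (doob_const s) * (\<integral>\<^sup>+x. F x powr s \<partial>\<nu>)"
    using F by (intro nn_integral_cmult) auto
  finally show ?thesis .
qed

section \<open>Geometry of cubes and balls\<close>

lemma ex_compact_ball:
  fixes \<mu> :: "'a::metric_space measure" and x :: 'a
  assumes "doubling_space \<mu>"
  obtains e K where "0 < e" "compact K" "ball x e \<subseteq> K"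
proof -
  have "\<forall>y::'a. \<exists>U. open U \<and> (\<exists>K. compact K \<and> y \<in> U \<and> U \<subseteq> K)"
    using assms by (simp add: doubling_space_def locally_compact_space_def)
  from spec[OF this, of x] obtain U K where "open U" "compact K" "x \<in> U" "U \<subseteq> K"
    by (elim exE conjE)
  obtain e where "0 < e" "ball x e \<subseteq> U"
    using openE[OF \<open>open U\<close> \<open>x \<in> U\<close>] .
  from this(1) \<open>compact K\<close> show ?thesis
    by (rule that) (rule order_trans[OF \<open>ball x e \<subseteq> U\<close> \<open>U \<subseteq> K\<close>])
qed

lemma doubling_iterate:
  assumes K: "\<forall>x r. 0 < r \<longrightarrow> emeasure \<mu> (ball x (2 * r)) \<le> ennreal K * emeasure \<mu> (ball x r)" and "0 < r"
  shows "emeasure \<mu> (ball x (2 ^ n * r)) \<le> ennreal K ^ n * emeasure \<mu> (ball x r)"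
proof (induction n)
  case (Suc n)
  have "emeasure \<mu> (ball x (2 * (2 ^ n * r))) \<le> ennreal K * emeasure \<mu> (ball x (2 ^ n * r))"
    using K \<open>0 < r\<close> by simp
  also have "\<dots> \<le> ennreal K * (ennreal K ^ n * emeasure \<mu> (ball x r))" by (intro mult_left_mono Suc) auto
  finally show ?case by (simp add: mult_ac)
qed auto

text \<open>Local compactness gives one ball of finite measure around each point, and doubling enlarges
  it.\<close>

lemma emeasure_ball_finite:
  assumes ds: "doubling_space \<mu>"
  shows "emeasure \<mu> (ball x r) < \<infinity>"
proof -
  obtain e K where e: "0 < e" "compact K" "ball x e \<subseteq> K" using ex_compact_ball[OF ds] .
  obtain D where D: "\<forall>x r. 0 < r \<longrightarrow> emeasure \<mu> (ball x (2 * r)) \<le> ennreal D * emeasure \<mu> (ball x r)"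
    using ds by (auto simp: doubling_space_def doubling_measure_def)
  have sets: "ball y s \<in> sets \<mu>" for y s using ds by (simp add: doubling_space_def)
  have KS: "K \<in> sets \<mu>" using ds e by (simp add: doubling_space_def borel_compact)
  have fin: "emeasure \<mu> (ball x e) < \<infinity>"
    using emeasure_mono[OF e(3) KS] ds e(2) by (auto simp: doubling_space_def intro: le_less_trans)
  obtain n where n: "r / e < 2 ^ n" using real_arch_pow[of 2 "r / e"] by auto
  have "emeasure \<mu> (ball x r) \<le> emeasure \<mu> (ball x (2 ^ n * e))"
    using n e by (intro emeasure_mono sets) (auto simp: field_simps)
  also have "\<dots> \<le> ennreal D ^ n * emeasure \<mu> (ball x e)" by (rule doubling_iterate[OF D e(1)])
  also have "\<dots> < \<infinity>" using fin by (simp add: ennreal_mult_less_top power_less_top_ennreal)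
  finally show ?thesis .
qed

lemma dyadic_balls:
  assumes "dyadic_system \<D>"
  obtains \<delta> c C :: real where "0 < \<delta>" "\<delta> < 1" "0 < c" "c \<le> C"
    "\<forall>k. \<forall>Q\<in>\<D> k. \<exists>z. ball z (c * \<delta> powi k) \<subseteq> Q \<and> Q \<subseteq> ball z (C * \<delta> powi k)"
proof -
  have "\<exists>\<delta> c C :: real. 0 < \<delta> \<and> \<delta> < 1 \<and> 0 < c \<and> c \<le> C \<and>
        (\<forall>k. \<forall>Q\<in>\<D> k. \<exists>z. ball z (c * \<delta> powi k) \<subseteq> Q \<and> Q \<subseteq> ball z (C * \<delta> powi k))"
    using assms unfolding dyadic_system_def by (elim conjE)
  then obtain \<delta> c C :: real where d: "0 < \<delta>" "\<delta> < 1" "0 < c" "c \<le> C"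
    and balls: "\<forall>k. \<forall>Q\<in>\<D> k. \<exists>z. ball z (c * \<delta> powi k) \<subseteq> Q \<and> Q \<subseteq> ball z (C * \<delta> powi k)"
    by (elim exE conjE)
  show ?thesis by (rule that[OF d balls])
qed

lemma dyadic_nested:
  assumes "dyadic_system \<D>" "P \<in> (\<Union>k. \<D> k)" "Q \<in> (\<Union>k. \<D> k)"
  shows "P \<inter> Q = {} \<or> P \<subseteq> Q \<or> Q \<subseteq> P"
proof -
  have "\<forall>P\<in>(\<Union>k. \<D> k). \<forall>Q\<in>(\<Union>k. \<D> k). P \<inter> Q = {} \<or> P \<subseteq> Q \<or> Q \<subseteq> P"
    using assms(1) unfolding dyadic_system_def by (elim conjE)
  from bspec[OF bspec[OF this assms(2)] assms(3)] show ?thesis .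
qed

lemma ennreal_divide_mult_self:
  fixes a b :: ennreal
  assumes "0 < b" "b < \<infinity>"
  shows "a / b * b = a"
proof -
  have "b \<noteq> 0" "b \<noteq> top" using assms by auto
  then show ?thesis by (metis ennreal_divide_times ennreal_times_divide mult_divide_eq_ennreal)
qed

text \<open>Cubes fill a fixed proportion of a ball around them; this is how averages over cubes are
  compared with the maximal operator, which is defined with balls.\<close>

definition ball_dilation :: "'a::metric_space measure \<Rightarrow> 'a set set \<Rightarrow> real \<Rightarrow> bool" where
  "ball_dilation \<mu> \<Q> L \<longleftrightarrow> 0 < L \<and>
     (\<forall>Q\<in>\<Q>. \<exists>z r. 0 < r \<and> Q \<subseteq> ball z r \<and> emeasure \<mu> (ball z r) \<le> ennreal L * emeasure \<mu> Q)"

lemma cube_measure: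
  assumes ds: "doubling_space \<mu>" and dy: "dyadic_system \<D>" and Q: "Q \<in> (\<Union>k. \<D> k)"
  shows "Q \<in> sets \<mu>" "0 < emeasure \<mu> Q" "emeasure \<mu> Q < \<infinity>" "Q \<noteq> {}"
proof -
  obtain \<delta> c C :: real where d: "0 < \<delta>" "\<delta> < 1" "0 < c" "c \<le> C"
    "\<forall>k. \<forall>Q\<in>\<D> k. \<exists>z. ball z (c * \<delta> powi k) \<subseteq> Q \<and> Q \<subseteq> ball z (C * \<delta> powi k)"
    by (rule dyadic_balls[OF dy])
  obtain k where k: "Q \<in> \<D> k" using Q by auto
  obtain z where z: "ball z (c * \<delta> powi k) \<subseteq> Q" "Q \<subseteq> ball z (C * \<delta> powi k)" using bspec[OF spec[OF d(5)] k] by auto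
  show S: "Q \<in> sets \<mu>" using dy k ds by (auto simp: dyadic_system_def doubling_space_def)
  have r: "0 < c * \<delta> powi k" using d by simp
  have "ball z (c * \<delta> powi k) \<noteq> {}" using r by simp
  then have "0 < emeasure \<mu> (ball z (c * \<delta> powi k))" using ds by (auto simp: doubling_space_def)
  then show "0 < emeasure \<mu> Q" using emeasure_mono[OF z(1) S] by (auto intro: less_le_trans)
  then show "Q \<noteq> {}" by auto
  have "ball z (C * \<delta> powi k) \<in> sets \<mu>" using ds by (simp add: doubling_space_def)
  from emeasure_mono[OF z(2) this] show "emeasure \<mu> Q < \<infinity>"
    using emeasure_ball_finite[OF ds] by (rule le_less_trans)
qed

lemma ex_ball_dilation:
  assumes ds: "doubling_space \<mu>" and dy: "dyadic_system \<D>"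
  shows "\<exists>L. ball_dilation \<mu> (\<Union>k. \<D> k) L"
proof -
  obtain \<delta> c C :: real where d: "0 < \<delta>" "\<delta> < 1" "0 < c" "c \<le> C"
    "\<forall>k. \<forall>Q\<in>\<D> k. \<exists>z. ball z (c * \<delta> powi k) \<subseteq> Q \<and> Q \<subseteq> ball z (C * \<delta> powi k)"
    by (rule dyadic_balls[OF dy])
  obtain D where D: "\<forall>x r. 0 < r \<longrightarrow> emeasure \<mu> (ball x (2 * r)) \<le> ennreal D * emeasure \<mu> (ball x r)"
    using ds by (auto simp: doubling_space_def doubling_measure_def)
  \<comment> \<open>After \<open>n\<close> doublings the inner ball of a cube contains the outer one.\<close>
  obtain n where n: "C / c < 2 ^ n" using real_arch_pow[of 2 "C / c"] by auto
  have D1: "ennreal D \<le> ennreal (max 1 D)" by (intro ennreal_leI) auto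
  have "\<exists>z r. 0 < r \<and> Q \<subseteq> ball z r \<and> emeasure \<mu> (ball z r) \<le> ennreal (max 1 D ^ n) * emeasure \<mu> Q"
    if Q: "Q \<in> (\<Union>k. \<D> k)" for Q
  proof -
    obtain k where k: "Q \<in> \<D> k" using Q by auto
    obtain z where z: "ball z (c * \<delta> powi k) \<subseteq> Q" "Q \<subseteq> ball z (C * \<delta> powi k)" using bspec[OF spec[OF d(5)] k] by auto
    have dk: "0 < \<delta> powi k" using d by simp
    have le: "C * \<delta> powi k \<le> 2 ^ n * (c * \<delta> powi k)"
      using n d dk by (simp add: field_simps)
    have "ball z (2 ^ n * (c * \<delta> powi k)) \<in> sets \<mu>" using ds by (simp add: doubling_space_def)
    then have "emeasure \<mu> (ball z (C * \<delta> powi k)) \<le> emeasure \<mu> (ball z (2 ^ n * (c * \<delta> powi k)))"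
      using le by (intro emeasure_mono) auto
    also have "\<dots> \<le> ennreal D ^ n * emeasure \<mu> (ball z (c * \<delta> powi k))"
      using d dk by (intro doubling_iterate[OF D]) auto
    also have "\<dots> \<le> ennreal (max 1 D) ^ n * emeasure \<mu> Q"
      using z cube_measure(1)[OF ds dy Q] by (intro mult_mono power_mono D1 emeasure_mono) auto
    also have "ennreal (max 1 D) ^ n = ennreal (max 1 D ^ n)" by (simp add: ennreal_power)
    finally show ?thesis using z(2) d dk by (intro exI[of _ z] exI[of _ "C * \<delta> powi k"]) auto
  qed
  then show ?thesis unfolding ball_dilation_def by (intro exI[of _ "max 1 D ^ n"]) auto
qed

text \<open>The weight may have infinite mass on large cubes, but a sufficiently small cube around a
  given point lies in a compact set.\<close>

lemma ex_small_cube: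
  assumes ds: "doubling_space \<mu>" and dy: "dyadic_system \<D>" and u: "weight \<mu> u"
  shows "\<exists>Q\<in>(\<Union>k. \<D> k). mass \<mu> u Q < \<infinity>"
proof -
  obtain \<delta> c C :: real where d: "0 < \<delta>" "\<delta> < 1" "0 < c" "c \<le> C"
    "\<forall>k. \<forall>Q\<in>\<D> k. \<exists>z. ball z (c * \<delta> powi k) \<subseteq> Q \<and> Q \<subseteq> ball z (C * \<delta> powi k)"
    by (rule dyadic_balls[OF dy])
  obtain x :: 'a where True by simp
  obtain e K where e: "0 < e" "compact K" "ball x e \<subseteq> K" using ex_compact_ball[OF ds] .
  obtain n :: nat where n: "\<delta> ^ n < e / (2 * C)"
    using real_arch_pow_inv[of "e / (2 * C)" \<delta>] d e by auto
  have "partition_on UNIV (\<D> (int n))" using dy by (simp add: dyadic_system_def)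
  then obtain Q where Q: "Q \<in> \<D> (int n)" "x \<in> Q" unfolding partition_on_def by blast
  obtain z where z: "Q \<subseteq> ball z (C * \<delta> ^ n)" using bspec[OF spec[OF d(5)] Q(1)] by auto
  have "Q \<subseteq> K"
  proof
    fix y assume "y \<in> Q"
    then have "dist z y < C * \<delta> ^ n" "dist z x < C * \<delta> ^ n" using z Q by auto
    then have "dist x y < 2 * (C * \<delta> ^ n)" using dist_triangle3[of x y z] by linarith
    also have "\<dots> < e" using n d by (simp add: field_simps)
    finally show "y \<in> K" using e by auto
  qed
  have "set_integrable \<mu> K u" using u e by (simp add: weight_def)
  then have "(\<integral>\<^sup>+x. ennreal (norm (indicator K x *\<^sub>R u x)) \<partial>\<mu>) < \<infinity>"
    unfolding set_integrable_def integrable_iff_bounded by auto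
  moreover have "mass \<mu> u Q \<le> (\<integral>\<^sup>+x. ennreal (norm (indicator K x *\<^sub>R u x)) \<partial>\<mu>)"
    unfolding mass_def using \<open>Q \<subseteq> K\<close> by (intro nn_integral_mono) (auto simp: indicator_def intro!: ennreal_leI)
  ultimately show ?thesis using Q by (intro bexI[of _ Q]) (auto intro: le_less_trans)
qed

section \<open>The Carleson condition from the maximal operator\<close>

lemma mass_pos:
  assumes u: "weight \<mu> u" and Q: "Q \<in> sets \<mu>" "0 < emeasure \<mu> Q"
  shows "0 < mass \<mu> u Q"
proof (rule ccontr)
  assume "\<not> ?thesis"
  then have "mass \<mu> u Q = 0" by (simp add: zero_less_iff_neq_zero)
  moreover have [measurable]: "u \<in> borel_measurable \<mu>" using u by (simp add: weight_def)
  ultimately have "AE x in \<mu>. ennreal (u x) * indicator Q x = 0"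
    unfolding mass_def using Q by (subst (asm) nn_integral_0_iff_AE) auto
  moreover have "AE x in \<mu>. 0 < u x" using u by (simp add: weight_def)
  ultimately have "AE x in \<mu>. x \<notin> Q" by eventually_elim (auto simp: indicator_def split: if_splits)
  then have "emeasure \<mu> Q = 0" using Q by (subst (asm) AE_iff_measurable[of Q]) (auto dest: sets.sets_into_space)
  then show False using Q by simp
qed

text \<open>The average over \<open>Q\<close> is at most \<open>L\<close> times the average over the ball around it. The constant
  stands on the left so that the maximal function, whose measurability is not established,
  enters integrals without a factor.\<close>

lemma average_le_maximal:
  assumes ds: "doubling_space \<mu>" and L: "ball_dilation \<mu> \<Q> L" and Q: "Q \<in> \<Q>" "0 < emeasure \<mu> Q" "emeasure \<mu> Q < \<infinity>"
    and QR: "Q \<subseteq> R" and x: "x \<in> Q"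
  shows "ennreal (1 / L) * average \<mu> u Q \<le> HL_maximal \<mu> (\<lambda>z. u z * indicator R z) x"
proof -
  obtain z r where B: "0 < r" "Q \<subseteq> ball z r" "emeasure \<mu> (ball z r) \<le> ennreal L * emeasure \<mu> Q" and "0 < L"
    using L Q by (auto simp: ball_dilation_def)
  have m: "mass \<mu> u Q \<le> mass \<mu> (\<lambda>y. \<bar>u y * indicator R y\<bar>) (ball z r)"
    unfolding mass_def using B(2) QR by (intro nn_integral_mono) (auto simp: indicator_def intro!: ennreal_leI)
  have "ball z r \<in> sets \<mu>" using ds by (simp add: doubling_space_def)
  from emeasure_mono[OF B(2) this] Q have Bpos: "0 < emeasure \<mu> (ball z r)" by (auto intro: less_le_trans)
  obtain b where b: "emeasure \<mu> (ball z r) = ennreal b" "0 < b"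
    using Bpos emeasure_ball_finite[OF ds, of z r] by (cases "emeasure \<mu> (ball z r)") auto
  obtain q where q: "emeasure \<mu> Q = ennreal q" "0 < q"
    using Q by (cases "emeasure \<mu> Q") auto
  have "ennreal b \<le> ennreal (L * q)" using B(3) \<open>0 < L\<close> q b by (simp add: ennreal_mult)
  then have bq: "b \<le> L * q" using \<open>0 < L\<close> q b by (subst (asm) ennreal_le_iff) auto
  have "ennreal (1 / L) * (mass \<mu> u Q / emeasure \<mu> Q) = mass \<mu> u Q * (ennreal (1 / L) * ennreal (1 / q))"
    using q by (simp add: divide_ennreal_def inverse_ennreal inverse_eq_divide mult_ac)
  also have "ennreal (1 / L) * ennreal (1 / q) = ennreal (1 / (L * q))"
    using q \<open>0 < L\<close> by (simp add: ennreal_mult[symmetric])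
  finally have "ennreal (1 / L) * (mass \<mu> u Q / emeasure \<mu> Q) = mass \<mu> u Q * ennreal (1 / (L * q))" .
  also have "\<dots> \<le> mass \<mu> (\<lambda>y. \<bar>u y * indicator R y\<bar>) (ball z r) * ennreal (1 / b)"
    using bq b q \<open>0 < L\<close> by (intro mult_mono m ennreal_leI divide_left_mono) auto
  also have "\<dots> = average \<mu> (\<lambda>y. \<bar>u y * indicator R y\<bar>) (ball z r)"
    using b by (simp add: average_def divide_ennreal_def inverse_ennreal inverse_eq_divide)
  also have "\<dots> \<le> HL_maximal \<mu> (\<lambda>z. u z * indicator R z) x"
    unfolding HL_maximal_def using B x by (intro SUP_upper2[of "(z, r)"]) auto
  finally show ?thesis by (simp add: average_def)
qed

lemma mass_eq_average:
  assumes "0 < emeasure \<mu> Q" "emeasure \<mu> Q < \<infinity>"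
  shows "mass \<mu> u Q = average \<mu> u Q * emeasure \<mu> Q"
  unfolding average_def by (rule ennreal_divide_mult_self[OF assms, symmetric])

lemma maximal_integral_le:
  assumes m: "0 < mass \<mu> u R" "mass \<mu> u R < \<infinity>" and R: "R \<in> (\<Union>k. \<D> k)"
  shows "(\<integral>\<^sup>+x\<in>R. HL_maximal \<mu> (\<lambda>z. u z * indicator R z) x \<partial>\<mu>) \<le> Ainf_const \<mu> \<D> u * mass \<mu> u R"
    (is "?I \<le> _")
proof -
  have "?I / mass \<mu> u R \<le> Ainf_const \<mu> \<D> u" unfolding Ainf_const_def using R by (intro SUP_upper)
  then have "?I / mass \<mu> u R * mass \<mu> u R \<le> Ainf_const \<mu> \<D> u * mass \<mu> u R" by (rule mult_right_mono) simp
  then show ?thesis unfolding ennreal_divide_mult_self[OF m] .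
qed

text \<open>On a cube of finite mass the maximal function dominates a multiple of the average.\<close>

lemma Ainf_pos:
  assumes ds: "doubling_space \<mu>" and dy: "dyadic_system \<D>" and u: "weight \<mu> u"
  shows "0 < Ainf_const \<mu> \<D> u"
proof -
  obtain L where L: "ball_dilation \<mu> (\<Union>k. \<D> k) L" using ex_ball_dilation[OF ds dy] ..
  then have "0 < L" by (simp add: ball_dilation_def)
  obtain Q where Q: "Q \<in> (\<Union>k. \<D> k)" "mass \<mu> u Q < \<infinity>" using ex_small_cube[OF assms] by auto
  note c = cube_measure[OF ds dy Q(1)]
  have mp: "0 < mass \<mu> u Q" using mass_pos[OF u c(1,2)] .
  have "0 < ennreal (1 / L) * mass \<mu> u Q" using mp \<open>0 < L\<close> by (simp add: ennreal_zero_less_mult_iff)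
  also have "\<dots> = (\<integral>\<^sup>+x. (ennreal (1 / L) * average \<mu> u Q) * indicator Q x \<partial>\<mu>)"
    using c by (subst nn_integral_cmult_indicator) (auto simp: mass_eq_average mult.assoc)
  also have "\<dots> \<le> (\<integral>\<^sup>+x\<in>Q. HL_maximal \<mu> (\<lambda>z. u z * indicator Q z) x \<partial>\<mu>)"
    using average_le_maximal[OF ds L Q(1) c(2,3) order_refl]
    by (intro nn_integral_mono) (auto simp: indicator_def)
  also have "\<dots> \<le> Ainf_const \<mu> \<D> u * mass \<mu> u Q" by (rule maximal_integral_le[OF mp Q(2) Q(1)])
  finally show ?thesis by (simp add: ennreal_zero_less_mult_iff)
qed

text \<open>The sets \<open>E\<close> that remain of the cubes after removing their proper subcubes from \<open>S\<close> are
  disjoint and carry at least half of the measure, so the sum is at most \<open>2 L\<close> times the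
  integral over \<open>R\<close> of the localised maximal function.\<close>

lemma Carleson_mass:
  assumes ds: "doubling_space \<mu>" and dy: "dyadic_system \<D>" and L: "ball_dilation \<mu> (\<Union>k. \<D> k) L"
    and S: "finite S" "S \<subseteq> (\<Union>k. \<D> k)" "sparse_family \<mu> S"
    and u: "weight \<mu> u" and R: "R \<in> (\<Union>k. \<D> k)" "mass \<mu> u R < \<infinity>"
  shows "(\<Sum>Q\<in>{Q\<in>S. Q \<subseteq> R}. mass \<mu> u Q) \<le> ennreal (2 * L) * Ainf_const \<mu> \<D> u * mass \<mu> u R"
proof -
  define E where "E Q = Q - \<Union>{Q'\<in>S. Q' \<subset> Q}" for Q
  define M where "M = HL_maximal \<mu> (\<lambda>z. u z * indicator R z)"
  define a where "a Q = ennreal (1 / L) * average \<mu> u Q" for Q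
  have "0 < L" using L by (simp add: ball_dilation_def)
  have cube: "Q \<in> sets \<mu>" "0 < emeasure \<mu> Q" "emeasure \<mu> Q < \<infinity>" if "Q \<in> S" for Q
    using cube_measure[OF ds dy subsetD[OF S(2) that]] by auto
  have US: "\<Union>{Q'\<in>S. Q' \<subset> Q} \<in> sets \<mu>" for Q using S cube by (intro sets.finite_Union) auto
  have ES: "E Q \<in> sets \<mu>" if "Q \<in> S" for Q using US cube[OF that] by (auto simp: E_def)
  have disj: "Q = Q'" if "Q \<in> S" "Q' \<in> S" "x \<in> E Q" "x \<in> E Q'" for Q Q' x
  proof -
    have "Q \<inter> Q' = {} \<or> Q \<subseteq> Q' \<or> Q' \<subseteq> Q" by (rule dyadic_nested[OF dy subsetD[OF S(2) that(1)] subsetD[OF S(2) that(2)]])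
    then show ?thesis using that unfolding E_def by blast
  qed
  have half: "emeasure \<mu> Q \<le> 2 * emeasure \<mu> (E Q)" if Q: "Q \<in> S" for Q
  proof -
    let ?U = "\<Union>{Q'\<in>S. Q' \<subset> Q}"
    have le: "emeasure \<mu> ?U \<le> emeasure \<mu> Q / 2" using S(3) Q by (simp add: sparse_family_def)
    have "emeasure \<mu> Q = emeasure \<mu> ?U + emeasure \<mu> (E Q)"
      unfolding E_def using cube[OF Q] US Q
      by (subst plus_emeasure) (auto intro!: arg_cong[where f = "emeasure \<mu>"])
    obtain q where q: "emeasure \<mu> Q = ennreal q" "0 \<le> q" using cube[OF Q] by (cases "emeasure \<mu> Q") auto
    have "emeasure \<mu> (E Q) \<le> emeasure \<mu> Q" using cube[OF Q] by (intro emeasure_mono) (auto simp: E_def)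
    then obtain s where s: "emeasure \<mu> (E Q) = ennreal s" "0 \<le> s"
      using q by (cases "emeasure \<mu> (E Q)") (auto simp: top_unique)
    have "emeasure \<mu> Q \<le> emeasure \<mu> Q / 2 + emeasure \<mu> (E Q)"
      using \<open>emeasure \<mu> Q = emeasure \<mu> ?U + emeasure \<mu> (E Q)\<close> le by (metis add_right_mono)
    also have "emeasure \<mu> Q / 2 = ennreal (q / 2)" using q by (simp add: divide_ennreal[symmetric])
    finally have "ennreal q \<le> ennreal (q / 2 + s)" using q s by simp
    then have "q \<le> 2 * s" using q s by (subst (asm) ennreal_le_iff) auto
    then have "ennreal q \<le> ennreal (2 * s)" by (rule ennreal_leI)
    then show ?thesis using q s by (simp add: ennreal_mult)
  qed
  have ptw: "(\<Sum>Q\<in>{Q\<in>S. Q \<subseteq> R}. a Q * indicator (E Q) x) \<le> M x * indicator R x" for x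
  proof (cases "\<exists>Q\<in>{Q\<in>S. Q \<subseteq> R}. x \<in> E Q")
    case True
    then obtain Q where Q: "Q \<in> S" "Q \<subseteq> R" "x \<in> E Q" by auto
    have xQ: "x \<in> Q" using Q(3) unfolding E_def by (rule DiffD1)
    have xR: "x \<in> R" using Q(2) xQ by (rule subsetD)
    have "(\<Sum>Q\<in>{Q\<in>S. Q \<subseteq> R}. a Q * indicator (E Q) x) = (\<Sum>Q\<in>{Q}. a Q * indicator (E Q) x)"
    proof (rule sum.mono_neutral_right)
      show "\<forall>P\<in>{Q\<in>S. Q \<subseteq> R} - {Q}. a P * indicator (E P) x = 0"
      proof
        fix P assume "P \<in> {Q\<in>S. Q \<subseteq> R} - {Q}"
        then have "x \<notin> E P" using disj[OF Q(1) _ Q(3), of P] by auto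
        then show "a P * indicator (E P) x = 0" by simp
      qed
    qed (use S(1) Q in auto)
    also have "\<dots> = a Q" using Q by simp
    also have "\<dots> \<le> M x" unfolding a_def M_def
      by (rule average_le_maximal[OF ds L subsetD[OF S(2) Q(1)] cube(2,3)[OF Q(1)] Q(2) xQ])
    also have "M x = M x * indicator R x" using xR by simp
    finally show ?thesis .
  next
    case False
    then show ?thesis by (simp add: indicator_def)
  qed
  have "(\<Sum>Q\<in>{Q\<in>S. Q \<subseteq> R}. mass \<mu> u Q) \<le> (\<Sum>Q\<in>{Q\<in>S. Q \<subseteq> R}. ennreal (2 * L) * (\<integral>\<^sup>+x. a Q * indicator (E Q) x \<partial>\<mu>))"
  proof (rule sum_mono)
    fix Q assume "Q \<in> {Q\<in>S. Q \<subseteq> R}"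
    then have Q: "Q \<in> S" by auto
    have "mass \<mu> u Q = average \<mu> u Q * emeasure \<mu> Q" using cube[OF Q] by (intro mass_eq_average)
    also have "\<dots> \<le> average \<mu> u Q * (2 * emeasure \<mu> (E Q))" by (intro mult_left_mono half Q) auto
    also have "\<dots> = ennreal (2 * L) * ennreal (1 / L) * (average \<mu> u Q * emeasure \<mu> (E Q))"
      using \<open>0 < L\<close> by (simp add: ennreal_mult[symmetric] mult_ac)
    also have "\<dots> = ennreal (2 * L) * (\<integral>\<^sup>+x. a Q * indicator (E Q) x \<partial>\<mu>)"
      unfolding nn_integral_cmult_indicator[OF ES[OF Q]] a_def by (simp only: mult_ac)
    finally show "mass \<mu> u Q \<le> ennreal (2 * L) * (\<integral>\<^sup>+x. a Q * indicator (E Q) x \<partial>\<mu>)" .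
  qed
  also have "\<dots> = ennreal (2 * L) * (\<Sum>Q\<in>{Q\<in>S. Q \<subseteq> R}. \<integral>\<^sup>+x. a Q * indicator (E Q) x \<partial>\<mu>)"
    by (simp add: sum_distrib_left)
  also have "(\<Sum>Q\<in>{Q\<in>S. Q \<subseteq> R}. \<integral>\<^sup>+x. a Q * indicator (E Q) x \<partial>\<mu>)
     = (\<integral>\<^sup>+x. (\<Sum>Q\<in>{Q\<in>S. Q \<subseteq> R}. a Q * indicator (E Q) x) \<partial>\<mu>)"
    by (rule nn_integral_sum[symmetric]) (use ES in auto)
  also have "\<dots> \<le> (\<integral>\<^sup>+x\<in>R. M x \<partial>\<mu>)" by (intro nn_integral_mono ptw)
  also have "\<dots> \<le> Ainf_const \<mu> \<D> u * mass \<mu> u R"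
    unfolding M_def using mass_pos[OF u] cube_measure[OF ds dy R(1)] R by (intro maximal_integral_le) auto
  finally show ?thesis by (simp add: mult_left_mono mult.assoc)
qed

section \<open>Changing the weight\<close>

definition weighted :: "'a measure \<Rightarrow> ('a \<Rightarrow> real) \<Rightarrow> 'a measure" where
  "weighted \<mu> u = density \<mu> (\<lambda>x. ennreal (u x))"

lemma sets_weighted [simp]: "sets (weighted \<mu> u) = sets \<mu>"
  by (simp add: weighted_def)

lemma emeasure_weighted:
  assumes "weight \<mu> u" "Q \<in> sets \<mu>"
  shows "emeasure (weighted \<mu> u) Q = mass \<mu> u Q"
  unfolding weighted_def mass_def using assms by (intro emeasure_density) (auto simp: weight_def)

text \<open>The last identity holds because \<open>u\<close> is exactly the power of \<open>w\<close> for which \<open>u\<^bsup>1 - p/a\<^esup> = w\<close>.\<close>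

lemma change_of_weight:
  fixes h w :: "'a::metric_space \<Rightarrow> real" and a p :: real
  assumes a: "0 < a" "a < p" and w: "weight \<mu> w" and u: "u = (\<lambda>x. w x powr (a / (a - p)))" "weight \<mu> u"
    and h: "h \<in> borel_measurable \<mu>" and F_def: "F = (\<lambda>x. \<bar>h x\<bar> powr a / u x)"
  shows "F \<in> borel_measurable (weighted \<mu> u)" "0 \<le> F x"
    and "Q \<in> sets \<mu> \<Longrightarrow> (\<integral>\<^sup>+x\<in>Q. F x \<partial>weighted \<mu> u) = mass \<mu> (\<lambda>x. \<bar>h x\<bar> powr a) Q"
    and "(\<integral>\<^sup>+x. F x powr (p / a) \<partial>weighted \<mu> u) = (\<integral>\<^sup>+x. ennreal (\<bar>h x\<bar> powr p * w x) \<partial>\<mu>)"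
proof -
  have um [measurable]: "u \<in> borel_measurable \<mu>" and upos: "AE x in \<mu>. 0 < u x"
    using u(2) by (auto simp: weight_def)
  have wpos: "AE x in \<mu>. 0 < w x" using w by (auto simp: weight_def)
  note [measurable] = h
  have Fm [measurable]: "F \<in> borel_measurable \<mu>" unfolding F_def by measurable
  then show "F \<in> borel_measurable (weighted \<mu> u)" by (simp add: weighted_def)
  show F0: "0 \<le> F x" for x by (simp add: F_def u(1))
  show "(\<integral>\<^sup>+x\<in>Q. F x \<partial>weighted \<mu> u) = mass \<mu> (\<lambda>x. \<bar>h x\<bar> powr a) Q" if [measurable]: "Q \<in> sets \<mu>"
  proof -
    have "(\<integral>\<^sup>+x\<in>Q. F x \<partial>weighted \<mu> u) = (\<integral>\<^sup>+x. ennreal (u x) * (ennreal (F x) * indicator Q x) \<partial>\<mu>)"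
      unfolding weighted_def by (intro nn_integral_density) measurable
    also have "\<dots> = mass \<mu> (\<lambda>x. \<bar>h x\<bar> powr a) Q"
      unfolding mass_def
    proof (rule nn_integral_cong_AE, use upos in eventually_elim)
      fix x assume "0 < u x"
      then have "ennreal (u x) * ennreal (F x) = ennreal (\<bar>h x\<bar> powr a)"
        by (simp add: F_def ennreal_mult[symmetric])
      then show "ennreal (u x) * (ennreal (F x) * indicator Q x) = ennreal (\<bar>h x\<bar> powr a) * indicator Q x"
        by (simp add: mult.assoc[symmetric])
    qed
    finally show ?thesis .
  qed
  have "(\<integral>\<^sup>+x. F x powr (p / a) \<partial>weighted \<mu> u) = (\<integral>\<^sup>+x. ennreal (u x) * ennreal (F x powr (p / a)) \<partial>\<mu>)"
    unfolding weighted_def by (intro nn_integral_density) measurable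
  also have "\<dots> = (\<integral>\<^sup>+x. ennreal (\<bar>h x\<bar> powr p * w x) \<partial>\<mu>)"
  proof (rule nn_integral_cong_AE, use upos wpos in eventually_elim)
    fix x assume pos: "0 < u x" "0 < w x"
    have "u x * F x powr (p / a) = \<bar>h x\<bar> powr p * (u x powr 1 / u x powr (p / a))"
      using pos a by (simp add: F_def powr_divide powr_powr)
    also have "u x powr 1 / u x powr (p / a) = u x powr (1 - p / a)" by (rule powr_diff[symmetric])
    also have "\<dots> = w x powr ((a / (a - p)) * (1 - p / a))" by (simp add: u(1) powr_powr)
    also have "(a / (a - p)) * (1 - p / a) = 1" using a by (simp add: field_simps)
    finally have "u x * F x powr (p / a) = \<bar>h x\<bar> powr p * w x" using pos by simp
    then show "ennreal (u x) * ennreal (F x powr (p / a)) = ennreal (\<bar>h x\<bar> powr p * w x)"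
      using pos by (simp add: ennreal_mult[symmetric])
  qed
  finally show "(\<integral>\<^sup>+x. F x powr (p / a) \<partial>weighted \<mu> u) = (\<integral>\<^sup>+x. ennreal (\<bar>h x\<bar> powr p * w x) \<partial>\<mu>)" .
qed

lemma Lp_space_integral:
  assumes "h \<in> Lp_space \<mu> p w" "0 < p"
  shows "(\<integral>\<^sup>+x. ennreal (\<bar>h x\<bar> powr p * w x) \<partial>\<mu>) = ennreal (enn2real (Lp_norm \<mu> p w h) powr p)"
proof -
  let ?I = "\<integral>\<^sup>+x. ennreal (\<bar>h x\<bar> powr p * w x) \<partial>\<mu>"
  have "?I powr\<^sub>e (1 / p) < \<infinity>" using assms by (simp add: Lp_space_def Lp_norm_def)
  then have fin: "?I < \<infinity>" by (auto simp: ennpowr_def less_top split: if_splits)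
  then have "enn2real (Lp_norm \<mu> p w h) = enn2real ?I powr (1 / p)"
    by (auto simp: Lp_norm_def ennpowr_def)
  then have "enn2real (Lp_norm \<mu> p w h) powr p = enn2real ?I"
    using assms(2) by (simp add: powr_powr)
  then show ?thesis using fin by simp
qed

text \<open>Pointwise \<open>F \<le> 1 + F\<^bsup>p/a\<^esup>\<close>.\<close>

lemma mass_finite:
  fixes h w :: "'a::metric_space \<Rightarrow> real" and a p :: real
  assumes a: "0 < a" "a < p" and w: "weight \<mu> w" and u: "u = (\<lambda>x. w x powr (a / (a - p)))" "weight \<mu> u"
    and h: "h \<in> Lp_space \<mu> p w" and Q: "Q \<in> sets \<mu>" "mass \<mu> u Q < \<infinity>"
  shows "mass \<mu> (\<lambda>x. \<bar>h x\<bar> powr a) Q < \<infinity>"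
proof -
  have hm: "h \<in> borel_measurable \<mu>" using h by (simp add: Lp_space_def)
  define F where "F = (\<lambda>x. \<bar>h x\<bar> powr a / u x)"
  note cw = change_of_weight[OF a w u hm F_def]
  have "mass \<mu> (\<lambda>x. \<bar>h x\<bar> powr a) Q = (\<integral>\<^sup>+x\<in>Q. F x \<partial>weighted \<mu> u)" using cw(3)[OF Q(1)] by simp
  also have "\<dots> \<le> (\<integral>\<^sup>+x. indicator Q x + ennreal (F x powr (p / a)) \<partial>weighted \<mu> u)"
  proof (rule nn_integral_mono)
    fix x
    have "F x \<le> 1 + F x powr (p / a)"
    proof (cases "F x \<le> 1")
      case False
      then have "F x powr 1 \<le> F x powr (p / a)" using a by (intro powr_mono) auto
      then show ?thesis using False by simp
    qed (use powr_ge_zero[of "F x" "p / a"] in linarith)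
    then have "ennreal (F x) \<le> 1 + ennreal (F x powr (p / a))"
      using ennreal_leI by (fastforce simp: ennreal_plus)
    then show "ennreal (F x) * indicator Q x \<le> indicator Q x + ennreal (F x powr (p / a))"
      by (auto simp: indicator_def)
  qed
  also have "\<dots> = mass \<mu> u Q + (\<integral>\<^sup>+x. F x powr (p / a) \<partial>weighted \<mu> u)"
    using Q cw(1) emeasure_weighted[OF u(2) Q(1)] by (subst nn_integral_add) (auto intro!: borel_measurable_indicator)
  also have "\<dots> < \<infinity>"
    using Q a Lp_space_integral[OF h] by (simp add: cw(4))
  finally show ?thesis .
qed

text \<open>This is Doob's inequality for \<open>F\<close> and the measure \<open>u dx\<close>, whose averages are \<open>\<phi>\<close>: tops on
  the same level are disjoint, and at a top of level \<open>i\<close> the average is at least \<open>2\<^sup>i\<close>.\<close>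

lemma tops_level_sum_le:
  fixes h w :: "'a::metric_space \<Rightarrow> real" and a p :: real
  assumes a: "0 < a" "a < p" and w: "weight \<mu> w" and u: "u = (\<lambda>x. w x powr (a / (a - p)))" "weight \<mu> u"
    and h: "h \<in> Lp_space \<mu> p w"
    and S: "finite S" "laminar S" "S \<subseteq> sets \<mu>" "\<And>Q. Q \<in> S \<Longrightarrow> 0 < mass \<mu> u Q \<and> mass \<mu> u Q < \<infinity>"
  defines "\<phi> \<equiv> \<lambda>Q. enn2real (mass \<mu> (\<lambda>x. \<bar>h x\<bar> powr a) Q) / enn2real (mass \<mu> u Q)"
  assumes pos: "\<And>Q. Q \<in> S \<Longrightarrow> 0 < \<phi> Q"
  shows "(\<Sum>R\<in>tops S (level S \<phi>). 2 powr (p / a * level S \<phi> R) * enn2real (mass \<mu> u R))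
    \<le> doob_const (p / a) * enn2real (Lp_norm \<mu> p w h) powr p"
proof -
  have hm: "h \<in> borel_measurable \<mu>" using h by (simp add: Lp_space_def)
  define F where "F = (\<lambda>x. \<bar>h x\<bar> powr a / u x)"
  note cw = change_of_weight[OF a w u hm F_def]
  let ?T = "tops S (level S \<phi>)"
  have TS: "?T \<subseteq> S" by (rule tops_subset)
  have finT: "finite ?T" using TS S(1) by (rule finite_subset)
  have em: "emeasure (weighted \<mu> u) R = ennreal (enn2real (mass \<mu> u R))" if "R \<in> S" for R
    using emeasure_weighted[OF u(2)] S that by (auto simp: subset_iff)
  have "(\<Sum>R\<in>?T. ennreal (2 powr (p / a * level S \<phi> R)) * emeasure (weighted \<mu> u) R)
    \<le> ennreal (doob_const (p / a)) * (\<integral>\<^sup>+x. F x powr (p / a) \<partial>weighted \<mu> u)"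
  proof (rule doob_tops[OF finT _ _ _ cw(1,2)])
    show "1 < p / a" using a by simp
    show "?T \<subseteq> sets (weighted \<mu> u)" using TS S(3) by auto
    show "emeasure (weighted \<mu> u) R < \<infinity>" if "R \<in> ?T" for R using em TS that by auto
    show "R \<inter> R' = {}" if "R \<in> ?T" "R' \<in> ?T" "level S \<phi> R = level S \<phi> R'" "R \<noteq> R'" for R R'
      using tops_disjoint[OF S(2) that] .
    show "ennreal (2 powr level S \<phi> R) * emeasure (weighted \<mu> u) R \<le> (\<integral>\<^sup>+x\<in>R. F x \<partial>weighted \<mu> u)" if "R \<in> ?T" for R
    proof -
      have RS: "R \<in> S" using that TS by auto
      then have Rs: "R \<in> sets \<mu>" using S(3) by auto
      have U: "0 < enn2real (mass \<mu> u R)" using S(4)[OF RS] by (simp add: enn2real_positive_iff)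
      have "2 powr level S \<phi> R * enn2real (mass \<mu> u R) \<le> \<phi> R * enn2real (mass \<mu> u R)"
        using level_top_le[OF S(1) that pos] U by (intro mult_right_mono) auto
      also have "\<dots> = enn2real (mass \<mu> (\<lambda>x. \<bar>h x\<bar> powr a) R)" using U by (simp add: \<phi>_def)
      finally have "ennreal (2 powr level S \<phi> R * enn2real (mass \<mu> u R)) \<le> ennreal (enn2real (mass \<mu> (\<lambda>x. \<bar>h x\<bar> powr a) R))"
        by (rule ennreal_leI)
      also have "\<dots> = (\<integral>\<^sup>+x\<in>R. F x \<partial>weighted \<mu> u)"
        using mass_finite[OF a w u h Rs] S(4)[OF RS] cw(3)[OF Rs] by simp
      finally show ?thesis using em[OF RS] by (simp add: ennreal_mult)
    qed
  qed
  also have "(\<Sum>R\<in>?T. ennreal (2 powr (p / a * level S \<phi> R)) * emeasure (weighted \<mu> u) R)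
    = (\<Sum>R\<in>?T. ennreal (2 powr (p / a * level S \<phi> R) * enn2real (mass \<mu> u R)))"
    using em TS by (intro sum.cong) (auto simp: ennreal_mult)
  also have "\<dots> = ennreal (\<Sum>R\<in>?T. 2 powr (p / a * level S \<phi> R) * enn2real (mass \<mu> u R))"
    by (intro sum_ennreal) auto
  also have "(\<integral>\<^sup>+x. F x powr (p / a) \<partial>weighted \<mu> u) = ennreal (enn2real (Lp_norm \<mu> p w h) powr p)"
    using a Lp_space_integral[OF h] by (simp add: cw(4))
  also have "ennreal (doob_const (p / a)) * ennreal (enn2real (Lp_norm \<mu> p w h) powr p)
     = ennreal (doob_const (p / a) * enn2real (Lp_norm \<mu> p w h) powr p)"
    by (simp add: ennreal_mult'')
  finally show ?thesis
  proof (subst (asm) ennreal_le_iff)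
    have "2 powr - (p / a - 1) < (1::real)" using a by (intro powr_less_one) auto
    then have "0 \<le> doob_const (p / a)" by (simp add: doob_const_def)
    then show "0 \<le> doob_const (p / a) * enn2real (Lp_norm \<mu> p w h) powr p" by simp
  qed
qed

section \<open>The sparse form of a finite family\<close>

lemma disjoint_sum_emeasure_le:
  assumes "finite C" "C \<subseteq> sets M" "disjoint C" "\<And>Q. Q \<in> C \<Longrightarrow> Q \<subseteq> X" "X \<in> sets M"
  shows "(\<Sum>Q\<in>C. emeasure M Q) \<le> emeasure M X"
proof -
  have "(\<Sum>Q\<in>C. emeasure M (id Q)) = emeasure M (\<Union>Q\<in>C. id Q)"
    using assms by (intro sum_emeasure) (auto simp: disjoint_family_on_def disjoint_def)
  also have "\<dots> \<le> emeasure M X" using assms by (intro emeasure_mono) auto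
  finally show ?thesis by simp
qed

lemma average_finite:
  assumes "mass \<mu> h Q < \<infinity>" "0 < emeasure \<mu> Q" "emeasure \<mu> Q < \<infinity>"
  shows "average \<mu> h Q = ennreal (enn2real (mass \<mu> h Q) / measure \<mu> Q)"
proof -
  have m: "emeasure \<mu> Q = ennreal (measure \<mu> Q)" "0 < measure \<mu> Q"
    using assms by (auto simp: measure_def enn2real_positive_iff)
  have "average \<mu> h Q = ennreal (enn2real (mass \<mu> h Q)) / ennreal (measure \<mu> Q)"
    using assms(1) m(1) by (simp add: average_def)
  then show ?thesis using m(2) by (simp add: divide_ennreal)
qed

lemma ennpowr_ennreal: "0 \<le> x \<Longrightarrow> ennreal x powr\<^sub>e a = ennreal (x powr a)"
  by (simp add: ennpowr_def)

lemma ennpowr_finite: "x < \<infinity> \<Longrightarrow> x powr\<^sub>e a = ennreal (enn2real x powr a)"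
  by (auto simp: ennpowr_def)

lemma sum_emeasure_real_le:
  assumes C: "finite C" "\<And>Q. Q \<in> C \<Longrightarrow> e Q = ennreal (c Q) \<and> 0 \<le> c Q" and le: "(\<Sum>Q\<in>C. e Q) \<le> ennreal b" "0 \<le> b"
  shows "(\<Sum>Q\<in>C. c Q) \<le> b"
proof -
  have "(\<Sum>Q\<in>C. e Q) = (\<Sum>Q\<in>C. ennreal (c Q))" using C by (intro sum.cong) auto
  also have "\<dots> = ennreal (\<Sum>Q\<in>C. c Q)" using C by (intro sum_ennreal) auto
  finally show ?thesis using le by (simp add: ennreal_le_iff)
qed

text \<open>In a product of positive extended numbers that is finite, both factors are finite.\<close>

lemma Ar_finite_mass:
  assumes ds: "doubling_space \<mu>" and dy: "dyadic_system \<D>" and Q: "Q \<in> (\<Union>k. \<D> k)"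
    and u: "weight \<mu> u" and v: "weight \<mu> v" and A: "Ar_const \<mu> \<D> (\<rho> + 1) v u < \<infinity>"
  shows "mass \<mu> u Q < \<infinity>" "mass \<mu> v Q < \<infinity>"
    and "average \<mu> v Q * average \<mu> u Q powr\<^sub>e \<rho> \<le> Ar_const \<mu> \<D> (\<rho> + 1) v u"
    and "0 < average \<mu> v Q * average \<mu> u Q powr\<^sub>e \<rho>"
proof -
  note c = cube_measure[OF ds dy Q]
  show le: "average \<mu> v Q * average \<mu> u Q powr\<^sub>e \<rho> \<le> Ar_const \<mu> \<D> (\<rho> + 1) v u"
    unfolding Ar_const_def using Q by (intro SUP_upper2[of Q]) auto
  have fin: "average \<mu> v Q * average \<mu> u Q powr\<^sub>e \<rho> < \<infinity>" using le A by (rule le_less_trans)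
  have avpos: "0 < average \<mu> h Q" if "weight \<mu> h" for h
    using mass_pos[OF that c(1,2)] mass_eq_average[OF c(2,3), of h] by (auto simp: zero_less_iff_neq_zero)
  have up: "0 < average \<mu> u Q powr\<^sub>e \<rho>"
  proof (cases "average \<mu> u Q = \<infinity>")
    case False
    then have "0 < enn2real (average \<mu> u Q)" using avpos[OF u] by (auto simp: enn2real_positive_iff less_top)
    then show ?thesis using False by (simp add: ennpowr_def)
  qed (simp add: ennpowr_def)
  show "0 < average \<mu> v Q * average \<mu> u Q powr\<^sub>e \<rho>"
    using avpos[OF v] up by (simp add: ennreal_zero_less_mult_iff)
  have "average \<mu> v Q < \<infinity>" "average \<mu> u Q powr\<^sub>e \<rho> < \<infinity>"
    using fin avpos[OF v] up by (auto simp: ennreal_mult_less_top)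
  then have "average \<mu> v Q < \<infinity>" "average \<mu> u Q < \<infinity>"
    by (auto simp: ennpowr_def less_top split: if_splits)
  then show "mass \<mu> u Q < \<infinity>" "mass \<mu> v Q < \<infinity>"
    using c(3) by (auto simp: mass_eq_average[OF c(2,3)] ennreal_mult_less_top)
qed

definition sparse_const :: "real \<Rightarrow> real \<Rightarrow> real \<Rightarrow> real \<Rightarrow> real" where
  "sparse_const p p' g \<rho> = 2 powr (1 / p + g * \<rho> + (1 / p' + g)) * stratum_const p p' g \<rho> / (1 - 2 powr - g)"

text \<open>The abstract estimate, applied to the masses of cubes: disjointness of subcubes gives
  superadditivity, sparseness the factor \<open>1/2\<close>, the \<open>A\<^sub>\<infinity>\<close> constants the Carleson conditions,
  and Doob's inequality the sums over tops. The exponents are \<open>a = p\<^sub>0\<close>, \<open>b = q\<^sub>0'\<close>,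
  \<open>\<rho> = r - 1\<close>, and \<open>g\<close> is the exponent of the \<open>A\<^sub>r\<close> constant.\<close>

lemma finite_sparse_form_le:
  fixes \<mu> :: "'a::metric_space measure" and a b p p' g \<rho> L :: real
  assumes ds: "doubling_space \<mu>" and dy: "dyadic_system \<D>" and L: "ball_dilation \<mu> (\<Union>k. \<D> k) L"
    and S: "finite S" "S \<subseteq> (\<Union>k. \<D> k)" "sparse_family \<mu> S"
    and ab: "0 < a" "a < p" "0 < b" "b < p'" and pp: "1 / p + 1 / p' = 1"
    and g: "0 < g" "g = 1 / b - 1 / p'" and \<rho>: "0 < \<rho>" "g * \<rho> = 1 / a - 1 / p"
    and w: "weight \<mu> w" and \<sigma>: "weight \<mu> \<sigma>"
    and u: "u = (\<lambda>x. w x powr (a / (a - p)))" "weight \<mu> u"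
    and v: "v = (\<lambda>x. \<sigma> x powr (b / (b - p')))" "weight \<mu> v"
    and A: "Ar_const \<mu> \<D> (\<rho> + 1) v u < \<infinity>"
    and Au: "Ainf_const \<mu> \<D> u < \<infinity>" and Av: "Ainf_const \<mu> \<D> v < \<infinity>"
    and f: "f \<in> Lp_space \<mu> p w" and h: "h \<in> Lp_space \<mu> p' \<sigma>"
  shows "(\<Sum>Q\<in>S. average \<mu> (\<lambda>x. \<bar>f x\<bar> powr a) Q powr\<^sub>e (1 / a)
            * average \<mu> (\<lambda>x. \<bar>h x\<bar> powr b) Q powr\<^sub>e (1 / b) * emeasure \<mu> Q)
    \<le> ennreal (sparse_const p p' g \<rho> * enn2real (Ar_const \<mu> \<D> (\<rho> + 1) v u) powr g
         * ((2 * L * enn2real (Ainf_const \<mu> \<D> u)) powr (1 / p) + (2 * L * enn2real (Ainf_const \<mu> \<D> v)) powr (1 / p'))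
         * (doob_const (p / a) * enn2real (Lp_norm \<mu> p w f) powr p) powr (1 / p)
         * (doob_const (p' / b) * enn2real (Lp_norm \<mu> p' \<sigma> h) powr p') powr (1 / p'))"
proof (cases "S = {}")
  case False
  have "0 < L" using L by (simp add: ball_dilation_def)
  have \<alpha>: "1 / a = 1 / p + g * \<rho>" and \<beta>: "1 / b = 1 / p' + g" using g \<rho> by auto
  have pa: "p / a = p * (1 / p + g * \<rho>)" and pb: "p' / b = p' * (1 / p' + g)"
    unfolding \<alpha>[symmetric] \<beta>[symmetric] by auto
  define m where "m Q = measure \<mu> Q" for Q
  define U where "U Q = enn2real (mass \<mu> u Q)" for Q
  define V where "V Q = enn2real (mass \<mu> v Q)" for Q
  define \<phi> where "\<phi> = (\<lambda>Q. enn2real (mass \<mu> (\<lambda>x. \<bar>f x\<bar> powr a) Q) / enn2real (mass \<mu> u Q))"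
  define \<psi> where "\<psi> = (\<lambda>Q. enn2real (mass \<mu> (\<lambda>x. \<bar>h x\<bar> powr b) Q) / enn2real (mass \<mu> v Q))"
  have cube: "Q \<in> (\<Union>k. \<D> k)" if "Q \<in> S" for Q using S(2) that by (rule subsetD)
  note cm = cube_measure[OF ds dy cube]
  note fm = Ar_finite_mass[OF ds dy cube u(2) v(2) A]
  have mp: "0 < mass \<mu> u Q" "0 < mass \<mu> v Q" if "Q \<in> S" for Q
    using mass_pos[OF u(2) cm(1,2)[OF that]] mass_pos[OF v(2) cm(1,2)[OF that]] .
  have pos: "0 < U Q \<and> 0 < V Q \<and> 0 < m Q" if "Q \<in> S" for Q
    using mp[OF that] fm(1,2)[OF that] cm(2,3)[OF that]
    by (auto simp: U_def V_def m_def measure_def enn2real_positive_iff)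
  have eU: "emeasure (weighted \<mu> u) Q = ennreal (U Q)" if "Q \<in> S" for Q
    using emeasure_weighted[OF u(2) cm(1)[OF that]] fm(1)[OF that] by (simp add: U_def)
  have eV: "emeasure (weighted \<mu> v) Q = ennreal (V Q)" if "Q \<in> S" for Q
    using emeasure_weighted[OF v(2) cm(1)[OF that]] fm(2)[OF that] by (simp add: V_def)
  have em: "emeasure \<mu> Q = ennreal (m Q)" if "Q \<in> S" for Q
    using cm(3)[OF that] by (simp add: m_def measure_def)
  have lam: "laminar S"
    unfolding laminar_def using cm(4) dyadic_nested[OF dy cube cube] by auto
  have sub: "sum U C \<le> U R \<and> sum V C \<le> V R \<and> sum m C \<le> m R / 2"
    if R: "R \<in> S" and C: "C \<subseteq> {Q \<in> S. Q \<subset> R}" and disj: "disjoint C" for R C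
  proof -
    have finC: "finite C" using C S(1) by (auto intro: finite_subset)
    have CS: "\<And>Q. Q \<in> C \<Longrightarrow> Q \<in> S" and CR: "\<And>Q. Q \<in> C \<Longrightarrow> Q \<subseteq> R" using C by auto
    have Cs: "C \<subseteq> sets \<mu>" using cm(1)[OF CS] by auto
    have 1: "(\<Sum>Q\<in>C. emeasure M Q) \<le> emeasure M R" if "sets M = sets \<mu>" for M
      using finC Cs disj CR cm(1)[OF R] that by (intro disjoint_sum_emeasure_le) auto
    have "sum U C \<le> U R"
      by (rule sum_emeasure_real_le[OF finC, where e = "emeasure (weighted \<mu> u)"])
        (use 1[of "weighted \<mu> u"] eU CS R pos in \<open>auto simp: less_imp_le\<close>)
    moreover have "sum V C \<le> V R"
      by (rule sum_emeasure_real_le[OF finC, where e = "emeasure (weighted \<mu> v)"])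
        (use 1[of "weighted \<mu> v"] eV CS R pos in \<open>auto simp: less_imp_le\<close>)
    moreover have "sum m C \<le> m R / 2"
    proof (rule sum_emeasure_real_le[OF finC, where e = "emeasure \<mu>"])
      have Us: "\<Union>{Q'\<in>S. Q' \<subset> R} \<in> sets \<mu>" using S(1) cm(1) by (intro sets.finite_Union) auto
      have "(\<Sum>Q\<in>C. emeasure \<mu> Q) \<le> emeasure \<mu> (\<Union>{Q'\<in>S. Q' \<subset> R})"
        using finC Cs disj C Us by (intro disjoint_sum_emeasure_le) auto
      also have "\<dots> \<le> emeasure \<mu> R / 2" using S(3) R by (simp add: sparse_family_def)
      also have "\<dots> = ennreal (m R / 2)" using em[OF R] pos[OF R] by (simp add: divide_ennreal[symmetric])
      finally show "(\<Sum>Q\<in>C. emeasure \<mu> Q) \<le> ennreal (m R / 2)" .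
    qed (use em CS R pos in \<open>auto simp: less_imp_le\<close>)
    ultimately show ?thesis by simp
  qed
  have Carl: "(\<Sum>Q\<in>{Q\<in>S. Q \<subseteq> R}. enn2real (mass \<mu> y Q)) \<le> 2 * L * enn2real (Ainf_const \<mu> \<D> y) * enn2real (mass \<mu> y R)"
    if R: "R \<in> S" and y: "weight \<mu> y" "\<And>Q. Q \<in> S \<Longrightarrow> mass \<mu> y Q < \<infinity>" "Ainf_const \<mu> \<D> y < \<infinity>" for R y
  proof (rule sum_emeasure_real_le[where e = "mass \<mu> y"])
    have "(\<Sum>Q\<in>{Q\<in>S. Q \<subseteq> R}. mass \<mu> y Q) \<le> ennreal (2 * L) * Ainf_const \<mu> \<D> y * mass \<mu> y R"
      by (rule Carleson_mass[OF ds dy L S y(1) cube[OF R] y(2)[OF R]])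
    also have "\<dots> = ennreal (2 * L) * ennreal (enn2real (Ainf_const \<mu> \<D> y)) * ennreal (enn2real (mass \<mu> y R))"
      using y(2)[OF R] y(3) by simp
    also have "\<dots> = ennreal (2 * L * enn2real (Ainf_const \<mu> \<D> y) * enn2real (mass \<mu> y R))"
      using \<open>0 < L\<close> by (simp only: ennreal_mult' enn2real_nonneg) (simp add: ennreal_mult)
    finally show "(\<Sum>Q\<in>{Q\<in>S. Q \<subseteq> R}. mass \<mu> y Q)
      \<le> ennreal (2 * L * enn2real (Ainf_const \<mu> \<D> y) * enn2real (mass \<mu> y R))" .
  qed (use S(1) y(2) \<open>0 < L\<close> in auto)
  obtain Q0 where Q0: "Q0 \<in> S" using False by auto
  have Apos: "0 < enn2real (Ar_const \<mu> \<D> (\<rho> + 1) v u)"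
    using less_le_trans[OF fm(4)[OF Q0] fm(3)[OF Q0]] A by (simp add: enn2real_positive_iff)
  have avg: "average \<mu> u Q = ennreal (U Q / m Q)" "average \<mu> v Q = ennreal (V Q / m Q)" if "Q \<in> S" for Q
    unfolding U_def V_def m_def
    using average_finite[OF fm(1)[OF that] cm(2,3)[OF that]] average_finite[OF fm(2)[OF that] cm(2,3)[OF that]] .
  have Ale: "V Q / m Q * (U Q / m Q) powr \<rho> \<le> enn2real (Ar_const \<mu> \<D> (\<rho> + 1) v u)" if Q: "Q \<in> S" for Q
  proof -
    have "ennreal (V Q / m Q * (U Q / m Q) powr \<rho>) = average \<mu> v Q * average \<mu> u Q powr\<^sub>e \<rho>"
      unfolding avg[OF Q] using pos[OF Q] by (subst ennpowr_ennreal, simp) (rule ennreal_mult, auto)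
    also have "\<dots> \<le> ennreal (enn2real (Ar_const \<mu> \<D> (\<rho> + 1) v u))" using fm(3)[OF Q] A by simp
    finally show ?thesis by (subst (asm) ennreal_le_iff) auto
  qed
  have mf: "mass \<mu> (\<lambda>x. \<bar>f x\<bar> powr a) Q < \<infinity>" "mass \<mu> (\<lambda>x. \<bar>h x\<bar> powr b) Q < \<infinity>" if "Q \<in> S" for Q
    using mass_finite[OF ab(1,2) w u f cm(1)[OF that] fm(1)[OF that]]
      mass_finite[OF ab(3,4) \<sigma> v h cm(1)[OF that] fm(2)[OF that]] .
  have term_eq: "average \<mu> (\<lambda>x. \<bar>f x\<bar> powr a) Q powr\<^sub>e (1 / a) * average \<mu> (\<lambda>x. \<bar>h x\<bar> powr b) Q powr\<^sub>e (1 / b) * emeasure \<mu> Q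
     = ennreal ((\<phi> Q * (U Q / m Q)) powr (1 / p + g * \<rho>) * (\<psi> Q * (V Q / m Q)) powr (1 / p' + g) * m Q)" if Q: "Q \<in> S" for Q
  proof -
    have "average \<mu> (\<lambda>x. \<bar>f x\<bar> powr a) Q = ennreal (\<phi> Q * (U Q / m Q))"
      using average_finite[OF mf(1)[OF Q] cm(2,3)[OF Q]] pos[OF Q] by (simp add: \<phi>_def U_def m_def)
    moreover have "average \<mu> (\<lambda>x. \<bar>h x\<bar> powr b) Q = ennreal (\<psi> Q * (V Q / m Q))"
      using average_finite[OF mf(2)[OF Q] cm(2,3)[OF Q]] pos[OF Q] by (simp add: \<psi>_def V_def m_def)
    moreover have "0 \<le> \<phi> Q * (U Q / m Q)" "0 \<le> \<psi> Q * (V Q / m Q)"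
      using pos[OF Q] by (auto simp: \<phi>_def \<psi>_def)
    ultimately show ?thesis using pos[OF Q] unfolding \<alpha> \<beta>
      by (simp only: ennpowr_ennreal em[OF Q] ennreal_mult'' powr_ge_zero less_imp_le)
  qed
  have main: "(\<Sum>Q\<in>S. (\<phi> Q * (U Q / m Q)) powr (1 / p + g * \<rho>) * (\<psi> Q * (V Q / m Q)) powr (1 / p' + g) * m Q)
    \<le> 2 powr (1 / p + g * \<rho> + (1 / p' + g)) * stratum_const p p' g \<rho> / (1 - 2 powr - g)
       * enn2real (Ar_const \<mu> \<D> (\<rho> + 1) v u) powr g
       * ((2 * L * enn2real (Ainf_const \<mu> \<D> u)) powr (1 / p) + (2 * L * enn2real (Ainf_const \<mu> \<D> v)) powr (1 / p'))
       * (doob_const (p / a) * enn2real (Lp_norm \<mu> p w f) powr p) powr (1 / p)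
       * (doob_const (p' / b) * enn2real (Lp_norm \<mu> p' \<sigma> h) powr p') powr (1 / p')"
  proof (rule sparse_form_le[OF S(1) lam pos sub _ _ pp \<rho>(1) g(1) Ale Apos])
    show "(\<Sum>R\<in>tops S' (level S' \<phi>). 2 powr (p * (1 / p + g * \<rho>) * level S' \<phi> R) * U R)
       \<le> doob_const (p / a) * enn2real (Lp_norm \<mu> p w f) powr p"
      if "S' \<subseteq> S" "\<And>Q. Q \<in> S' \<Longrightarrow> 0 < \<phi> Q" for S'
      unfolding pa[symmetric] U_def \<phi>_def
      by (rule tops_level_sum_le[OF ab(1,2) w u f])
        (use that finite_subset[OF that(1) S(1)] laminar_subset[OF lam that(1)] cm(1) mp fm(1) in \<open>auto simp: \<phi>_def\<close>)
    show "(\<Sum>R\<in>tops S' (level S' \<psi>). 2 powr (p' * (1 / p' + g) * level S' \<psi> R) * V R)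
       \<le> doob_const (p' / b) * enn2real (Lp_norm \<mu> p' \<sigma> h) powr p'"
      if "S' \<subseteq> S" "\<And>Q. Q \<in> S' \<Longrightarrow> 0 < \<psi> Q" for S'
      unfolding pb[symmetric] V_def \<psi>_def
      by (rule tops_level_sum_le[OF ab(3,4) \<sigma> v h])
        (use that finite_subset[OF that(1) S(1)] laminar_subset[OF lam that(1)] cm(1) mp fm(2) in \<open>auto simp: \<psi>_def\<close>)
    show "(\<Sum>Q\<in>{Q\<in>S. Q \<subseteq> R}. U Q) \<le> 2 * L * enn2real (Ainf_const \<mu> \<D> u) * U R" if "R \<in> S" for R
      unfolding U_def by (rule Carl[OF that u(2) fm(1) Au])
    show "(\<Sum>Q\<in>{Q\<in>S. Q \<subseteq> R}. V Q) \<le> 2 * L * enn2real (Ainf_const \<mu> \<D> v) * V R" if "R \<in> S" for R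
      unfolding V_def by (rule Carl[OF that v(2) fm(2) Av])
  qed (use ab \<open>0 < L\<close> in \<open>auto simp: \<phi>_def \<psi>_def\<close>)
  have "(\<Sum>Q\<in>S. average \<mu> (\<lambda>x. \<bar>f x\<bar> powr a) Q powr\<^sub>e (1 / a)
            * average \<mu> (\<lambda>x. \<bar>h x\<bar> powr b) Q powr\<^sub>e (1 / b) * emeasure \<mu> Q)
    = (\<Sum>Q\<in>S. ennreal ((\<phi> Q * (U Q / m Q)) powr (1 / p + g * \<rho>) * (\<psi> Q * (V Q / m Q)) powr (1 / p' + g) * m Q))"
    by (rule sum.cong[OF refl]) (rule term_eq)
  also have "\<dots> = ennreal (\<Sum>Q\<in>S. (\<phi> Q * (U Q / m Q)) powr (1 / p + g * \<rho>) * (\<psi> Q * (V Q / m Q)) powr (1 / p' + g) * m Q)"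
    using pos by (intro sum_ennreal) (auto simp: less_imp_le)
  finally show ?thesis using ennreal_leI[OF main] by (simp add: sparse_const_def)
qed simp

section \<open>Exponents and the main estimate\<close>

text \<open>For \<open>q\<^sub>0 < \<infinity>\<close> one has \<open>r - 1 = q\<^sub>0/(q\<^sub>0 - p) (p/p\<^sub>0 - 1)\<close> and
  \<open>1/q\<^sub>0' - 1/p' = (q\<^sub>0 - p)/(p q\<^sub>0)\<close>; for \<open>q\<^sub>0 = \<infinity>\<close> these are \<open>p/p\<^sub>0 - 1\<close> and \<open>1/p\<close>.\<close>

lemma exponent_relations:
  fixes p\<^sub>0 p p' q\<^sub>0' r :: real and q\<^sub>0 :: ereal
  assumes "1 \<le> p\<^sub>0" "p\<^sub>0 < p" "ereal p < q\<^sub>0"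
    and p': "ereal p' = conj_exponent (ereal p)"
    and q': "ereal q\<^sub>0' = conj_exponent q\<^sub>0"
    and r: "ereal r = conj_exponent (q\<^sub>0 / ereal p) * ereal (p / p\<^sub>0 - 1) + 1"
  shows "1 / p + 1 / p' = 1" "0 < q\<^sub>0'" "q\<^sub>0' < p'" "0 < r - 1"
    and "(1 / q\<^sub>0' - 1 / p') * (r - 1) = 1 / p\<^sub>0 - 1 / p"
proof -
  have p: "1 < p" using assms by linarith
  have p'_eq: "p' = p / (p - 1)"
    using p' conj_exponent_ereal[of p] p by (simp add: one_ereal_def)
  show "1 / p + 1 / p' = 1" using p by (simp add: p'_eq field_simps)
  have "0 < q\<^sub>0' \<and> q\<^sub>0' < p' \<and> 0 < r - 1 \<and> (1 / q\<^sub>0' - 1 / p') * (r - 1) = 1 / p\<^sub>0 - 1 / p"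
  proof (cases q\<^sub>0)
    case (real q)
    then have pq: "p < q" using assms(3) by simp
    have q'_eq: "q\<^sub>0' = q / (q - 1)"
      using q' conj_exponent_ereal[of q] p pq real by (simp add: one_ereal_def)
    have "conj_exponent (q\<^sub>0 / ereal p) = ereal ((q / p) / (q / p - 1))"
      using real p pq conj_exponent_ereal[of "q / p"] by (simp add: one_ereal_def)
    then have r_eq: "r = (q / p) / (q / p - 1) * (p / p\<^sub>0 - 1) + 1" using r by (simp add: one_ereal_def)
    have frac: "(q / p) / (q / p - 1) = q / (q - p)" using p pq by (simp add: field_simps)
    have r1: "r - 1 = q / (q - p) * (p / p\<^sub>0 - 1)" unfolding r_eq frac by (rule add_diff_cancel)
    have d: "1 / q\<^sub>0' - 1 / p' = (q - p) / (p * q)" using p pq by (simp add: q'_eq p'_eq field_simps)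
    have "(1 / q\<^sub>0' - 1 / p') * (r - 1) = 1 / p\<^sub>0 - 1 / p"
      using p pq assms(1) unfolding d r1 by (simp add: field_simps)
    moreover have "0 < q\<^sub>0'" "q\<^sub>0' < p'" using p pq by (auto simp: q'_eq p'_eq field_simps)
    moreover have "0 < r - 1" using p pq assms(1,2) unfolding r1 by (intro mult_pos_pos) auto
    ultimately show ?thesis by simp
  next
    case PInf
    then have q'_eq: "q\<^sub>0' = 1" using q' by (simp add: one_ereal_def)
    have "q\<^sub>0 / ereal p = \<infinity>" using PInf p by simp
    then have r1: "r - 1 = p / p\<^sub>0 - 1" using r by (simp add: one_ereal_def)
    have "(1 / q\<^sub>0' - 1 / p') * (r - 1) = 1 / p\<^sub>0 - 1 / p"
      using p assms(1) unfolding q'_eq p'_eq r1 by (simp add: field_simps)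
    moreover have "0 < q\<^sub>0'" "q\<^sub>0' < p'" using p by (auto simp: q'_eq p'_eq field_simps)
    moreover have "0 < r - 1" using assms(1,2) unfolding r1 by simp
    ultimately show ?thesis by simp
  next
    case MInf
    then show ?thesis using assms(3) by simp
  qed
  then show "0 < q\<^sub>0'" "q\<^sub>0' < p'" "0 < r - 1" "(1 / q\<^sub>0' - 1 / p') * (r - 1) = 1 / p\<^sub>0 - 1 / p" by auto
qed

lemma sparse_family_subset:
  assumes "sparse_family \<mu> S" "S' \<subseteq> S" "countable S" "S \<subseteq> sets \<mu>"
  shows "sparse_family \<mu> S'"
  unfolding sparse_family_def
proof
  fix Q assume Q: "Q \<in> S'"
  have "\<Union>{Q'\<in>S. Q' \<subset> Q} \<in> sets \<mu>"
    using assms(3,4) by (intro sets.countable_Union countable_subset[of "{Q'\<in>S. Q' \<subset> Q}" S]) auto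
  then have "emeasure \<mu> (\<Union>{Q'\<in>S'. Q' \<subset> Q}) \<le> emeasure \<mu> (\<Union>{Q'\<in>S. Q' \<subset> Q})"
    using assms(2) by (intro emeasure_mono) auto
  also have "\<dots> \<le> emeasure \<mu> Q / 2" using assms(1,2) Q by (auto simp: sparse_family_def)
  finally show "emeasure \<mu> (\<Union>{Q'\<in>S'. Q' \<subset> Q}) \<le> emeasure \<mu> Q / 2" .
qed

theorem theorem1p6:
  fixes \<mu> :: "'a::metric_space measure"
    and \<D> :: "int \<Rightarrow> 'a set set"
    and p\<^sub>0 p p' q\<^sub>0' r :: real
    and q\<^sub>0 :: ereal
  assumes "doubling_space \<mu>"
    and "dyadic_system \<D>"
    and "1 \<le> p\<^sub>0" and "p\<^sub>0 < p" and "ereal p < q\<^sub>0"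
    and "ereal p' = conj_exponent (ereal p)"
    and "ereal q\<^sub>0' = conj_exponent q\<^sub>0"
    and "ereal r = conj_exponent (q\<^sub>0 / ereal p) * ereal (p / p\<^sub>0 - 1) + 1"
  shows "\<exists>C::real. \<forall>\<S> w \<sigma> u v.
    \<S> \<subseteq> (\<Union>k. \<D> k) \<longrightarrow> sparse_family \<mu> \<S> \<longrightarrow>
    weight \<mu> w \<longrightarrow> weight \<mu> \<sigma> \<longrightarrow>
    u = (\<lambda>x. w x powr (p\<^sub>0 / (p\<^sub>0 - p))) \<longrightarrow> weight \<mu> u \<longrightarrow>
    v = (\<lambda>x. \<sigma> x powr (q\<^sub>0' / (q\<^sub>0' - p'))) \<longrightarrow> weight \<mu> v \<longrightarrow>
    best_const \<mu> \<S> p\<^sub>0 q\<^sub>0' p p' w \<sigma>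
      \<le> ennreal C * Ar_const \<mu> \<D> r v u powr\<^sub>e (1 / q\<^sub>0' - 1 / p')
          * (Ainf_const \<mu> \<D> u powr\<^sub>e (1 / p) + Ainf_const \<mu> \<D> v powr\<^sub>e (1 / p'))"
proof -
  note ds = assms(1) and dy = assms(2)
  note exps = exponent_relations[OF assms(3-8)]
  define \<rho> where "\<rho> = r - 1"
  define g where "g = 1 / q\<^sub>0' - 1 / p'"
  have \<rho>: "0 < \<rho>" "g * \<rho> = 1 / p\<^sub>0 - 1 / p" using exps by (auto simp: \<rho>_def g_def)
  have g: "0 < g" using exps(2,3) by (simp add: g_def divide_strict_left_mono)
  have p0: "0 < p\<^sub>0" "0 < p" "0 < p'" using assms(3,4) exps by auto
  have r: "\<rho> + 1 = r" by (simp add: \<rho>_def)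
  obtain L where L: "ball_dilation \<mu> (\<Union>k. \<D> k) L" using ex_ball_dilation[OF ds dy] ..
  then have "0 < L" by (simp add: ball_dilation_def)
  \<comment> \<open>A common bound for the two powers of \<open>2 L\<close> that the Carleson constants contribute.\<close>
  define c where "c = (2 * L) powr (1 / p) + (2 * L) powr (1 / p')"
  define D where "D = doob_const (p / p\<^sub>0) powr (1 / p) * doob_const (p' / q\<^sub>0') powr (1 / p')"
  \<comment> \<open>The summand 1 makes the constant positive, so that an infinite right-hand side stays infinite.\<close>
  define C where "C = 1 + sparse_const p p' g \<rho> * c * D"
  have "2 powr - g < (1::real)" using g by (intro powr_less_one) auto
  then have K0: "0 \<le> sparse_const p p' g \<rho>"
    using stratum_const_nonneg[OF p0(2,3) \<rho>(1), of g] by (simp add: sparse_const_def)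
  have c0: "0 \<le> c" and D0: "0 \<le> D" by (auto simp: c_def D_def)
  then have C: "0 < C" using K0 by (simp add: C_def add_pos_nonneg)
  show ?thesis
  proof (intro exI[of _ C] allI impI)
    fix \<S> w \<sigma> u v
    assume S: "\<S> \<subseteq> (\<Union>k. \<D> k)" "sparse_family \<mu> \<S>"
      and w: "weight \<mu> w" and \<sigma>: "weight \<mu> \<sigma>"
      and u: "u = (\<lambda>x. w x powr (p\<^sub>0 / (p\<^sub>0 - p)))" "weight \<mu> u"
      and v: "v = (\<lambda>x. \<sigma> x powr (q\<^sub>0' / (q\<^sub>0' - p')))" "weight \<mu> v"
    let ?A = "Ar_const \<mu> \<D> r v u" and ?Au = "Ainf_const \<mu> \<D> u" and ?Av = "Ainf_const \<mu> \<D> v"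
    let ?RHS = "ennreal C * ?A powr\<^sub>e g * (?Au powr\<^sub>e (1 / p) + ?Av powr\<^sub>e (1 / p'))"
    have Aupos: "0 < ?Au" and Avpos: "0 < ?Av" using Ainf_pos[OF ds dy] u(2) v(2) by auto
    have pos: "0 < x powr\<^sub>e e" if "0 < x" for x e
    proof (cases "x = \<infinity>")
      case False
      then have "0 < enn2real x" using that by (simp add: enn2real_positive_iff less_top)
      then show ?thesis using False by (simp add: ennpowr_def)
    qed (simp add: ennpowr_def)
    show "best_const \<mu> \<S> p\<^sub>0 q\<^sub>0' p p' w \<sigma>
      \<le> ennreal C * ?A powr\<^sub>e (1 / q\<^sub>0' - 1 / p') * (?Au powr\<^sub>e (1 / p) + ?Av powr\<^sub>e (1 / p'))"
      unfolding g_def[symmetric]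
    proof (cases "?A < \<infinity> \<and> ?Au < \<infinity> \<and> ?Av < \<infinity>")
      case False
      \<comment> \<open>All factors on the right are positive and one of them is infinite.\<close>
      have "?RHS = \<infinity>"
      proof (cases "?A = \<infinity>")
        case True
        have "0 < ?Au powr\<^sub>e (1 / p) + ?Av powr\<^sub>e (1 / p')" using pos[OF Aupos] by (simp add: add_pos_nonneg)
        then show ?thesis using True C by (auto simp: ennpowr_def ennreal_mult_eq_top_iff)
      next
        case A: False
        obtain Q where Q: "Q \<in> (\<Union>k. \<D> k)" using ex_small_cube[OF ds dy u(2)] by auto
        have Af: "Ar_const \<mu> \<D> (\<rho> + 1) v u < \<infinity>" using A by (simp add: r less_top)
        note fm = Ar_finite_mass[OF ds dy Q u(2) v(2) Af]
        have "0 < ?A" using less_le_trans[OF fm(4) fm(3)] by (simp add: r)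
        then have "0 < ennreal C * ?A powr\<^sub>e g" using pos C by (simp add: ennreal_zero_less_mult_iff)
        moreover have "?Au = \<infinity> \<or> ?Av = \<infinity>" using False A by (auto simp: less_top[symmetric])
        then have "?Au powr\<^sub>e (1 / p) + ?Av powr\<^sub>e (1 / p') = \<infinity>" by (auto simp: ennpowr_def)
        ultimately show ?thesis by (auto simp: ennreal_mult_eq_top_iff)
      qed
      then show "best_const \<mu> \<S> p\<^sub>0 q\<^sub>0' p p' w \<sigma> \<le> ?RHS" by simp
    next
      case True
      then have A: "Ar_const \<mu> \<D> (\<rho> + 1) v u < \<infinity>" and Au: "?Au < \<infinity>" and Av: "?Av < \<infinity>" by (auto simp: r)
      have cntD: "countable (\<Union>k. \<D> k)" using dy by (auto simp: dyadic_system_def)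
      have SM: "\<S> \<subseteq> sets \<mu>" using S(1) cube_measure(1)[OF ds dy] by auto
      show "best_const \<mu> \<S> p\<^sub>0 q\<^sub>0' p p' w \<sigma> \<le> ?RHS"
        unfolding best_const_def
      proof (rule Inf_lower, rule CollectI, intro ballI)
        fix f h assume f: "f \<in> Lp_space \<mu> p w" and h: "h \<in> Lp_space \<mu> p' \<sigma>"
        define Nf where "Nf = enn2real (Lp_norm \<mu> p w f)"
        define Nh where "Nh = enn2real (Lp_norm \<mu> p' \<sigma> h)"
        have N: "Lp_norm \<mu> p w f = ennreal Nf" "Lp_norm \<mu> p' \<sigma> h = ennreal Nh" "0 \<le> Nf" "0 \<le> Nh"
          using f h by (auto simp: Lp_space_def Nf_def Nh_def)
        define x where "x = enn2real ?Au powr (1 / p)"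
        define y where "y = enn2real ?Av powr (1 / p')"
        define z where "z = enn2real ?A powr g"
        have xyz: "0 \<le> x" "0 \<le> y" "0 \<le> z" by (auto simp: x_def y_def z_def)
        have RHS: "?RHS * Lp_norm \<mu> p w f * Lp_norm \<mu> p' \<sigma> h = ennreal (C * z * (x + y) * Nf * Nh)"
          using True C xyz N
          by (simp add: ennpowr_finite x_def[symmetric] y_def[symmetric] z_def[symmetric] ennreal_mult ennreal_plus)
        have "sparse_const p p' g \<rho> * z * ((2 * L * enn2real ?Au) powr (1 / p) + (2 * L * enn2real ?Av) powr (1 / p'))
            * (doob_const (p / p\<^sub>0) * Nf powr p) powr (1 / p) * (doob_const (p' / q\<^sub>0') * Nh powr p') powr (1 / p')
          \<le> C * z * (x + y) * Nf * Nh"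
        proof -
          have e1: "(doob_const (p / p\<^sub>0) * Nf powr p) powr (1 / p) = doob_const (p / p\<^sub>0) powr (1 / p) * Nf"
            using N p0 by (simp add: powr_mult powr_powr)
          have e2: "(doob_const (p' / q\<^sub>0') * Nh powr p') powr (1 / p') = doob_const (p' / q\<^sub>0') powr (1 / p') * Nh"
            using N p0 by (simp add: powr_mult powr_powr)
          have "(2 * L * enn2real ?Au) powr (1 / p) + (2 * L * enn2real ?Av) powr (1 / p')
             = (2 * L) powr (1 / p) * x + (2 * L) powr (1 / p') * y"
            by (simp add: powr_mult x_def y_def)
          also have "\<dots> \<le> c * x + c * y"
            using xyz by (intro add_mono mult_right_mono) (auto simp: c_def)
          finally have e3: "(2 * L * enn2real ?Au) powr (1 / p) + (2 * L * enn2real ?Av) powr (1 / p') \<le> c * (x + y)"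
            by (simp add: distrib_left)
          have "sparse_const p p' g \<rho> * z * ((2 * L * enn2real ?Au) powr (1 / p) + (2 * L * enn2real ?Av) powr (1 / p'))
             * (doob_const (p / p\<^sub>0) powr (1 / p) * Nf) * (doob_const (p' / q\<^sub>0') powr (1 / p') * Nh)
            \<le> sparse_const p p' g \<rho> * z * (c * (x + y))
             * (doob_const (p / p\<^sub>0) powr (1 / p) * Nf) * (doob_const (p' / q\<^sub>0') powr (1 / p') * Nh)"
            using e3 K0 xyz N by (intro mult_right_mono mult_left_mono) auto
          also have "\<dots> = (sparse_const p p' g \<rho> * c * D) * (z * (x + y) * Nf * Nh)"
            by (simp add: D_def mult_ac)
          also have "\<dots> \<le> C * (z * (x + y) * Nf * Nh)"
            using xyz N by (intro mult_right_mono) (auto simp: C_def)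
          finally show ?thesis unfolding e1 e2 by (simp add: mult_ac)
        qed
        note bound = ennreal_leI[OF this]
        show "sparse_form \<mu> \<S> p\<^sub>0 q\<^sub>0' f h \<le> ?RHS * Lp_norm \<mu> p w f * Lp_norm \<mu> p' \<sigma> h"
          unfolding sparse_form_def
        proof (rule infsum_le_finite_sums)
          fix F assume F: "finite F" "F \<subseteq> \<S>"
          have FD: "F \<subseteq> (\<Union>k. \<D> k)" using F(2) S(1) by (rule order_trans)
          have Fs: "sparse_family \<mu> F"
            by (rule sparse_family_subset[OF S(2) F(2) countable_subset[OF S(1) cntD] SM])
          have "(\<Sum>Q\<in>F. average \<mu> (\<lambda>x. \<bar>f x\<bar> powr p\<^sub>0) Q powr\<^sub>e (1 / p\<^sub>0)
            * average \<mu> (\<lambda>x. \<bar>h x\<bar> powr q\<^sub>0') Q powr\<^sub>e (1 / q\<^sub>0') * emeasure \<mu> Q)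
            \<le> ennreal (sparse_const p p' g \<rho> * z * ((2 * L * enn2real ?Au) powr (1 / p) + (2 * L * enn2real ?Av) powr (1 / p'))
            * (doob_const (p / p\<^sub>0) * Nf powr p) powr (1 / p) * (doob_const (p' / q\<^sub>0') * Nh powr p') powr (1 / p'))"
            unfolding z_def Nf_def Nh_def r[symmetric]
            by (rule finite_sparse_form_le[OF ds dy L F(1) FD Fs p0(1) assms(4) exps(2,3,1) g g_def \<rho> w \<sigma> u v A Au Av f h])
          also note bound
          finally show "(\<Sum>Q\<in>F. average \<mu> (\<lambda>x. \<bar>f x\<bar> powr p\<^sub>0) Q powr\<^sub>e (1 / p\<^sub>0)
            * average \<mu> (\<lambda>x. \<bar>h x\<bar> powr q\<^sub>0') Q powr\<^sub>e (1 / q\<^sub>0') * emeasure \<mu> Q)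
            \<le> ?RHS * Lp_norm \<mu> p w f * Lp_norm \<mu> p' \<sigma> h" unfolding RHS .
        qed (auto intro!: nonneg_summable_on_complete)
      qed
    qed
  qed
qed

end
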